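(* For every $J\in\mathbb Z_{>0}^m$, a puzzle $p\colon G(J)\to D'(K)$ is realizable if and only if all of its subsquares are realizable. Consequently, the D-J classes of $R$-characteristic maps over $K(J)$ are in bijection (via $\Lambda\mapsto(\boldsymbol\alpha\mapsto\operatorname{proj}_{\sigma(\boldsymbol\alpha)}\Lambda)$) with the puzzles $G(J)\to D'(K)$ all of whose subsquares are realizable.
   Context: Let $R\in\{\mathbb Z,\mathbb Z_2\}$; an $R$-basis of $R^n$ is a $\mathbb Z$-basis of $\mathbb Z^n$ ($R=\mathbb Z$) or a basis of $\mathbb Z_2^n$ ($R=\mathbb Z_2$). $K$ is an $(n-1)$-dimensional star-shaped simplicial sphere on $[m]$. An $R$-characteristic map over a complex with $(N-1)$-dimensional facets is a map from its vertices to $R^N$ sending each $(N-1)$-face to an $R$-basis; D-J equivalence is equality up to left multiplication by $GL_N(R)$. For a face $\sigma$, $\operatorname{proj}_\sigma\lambda$ is the characteristic map on $\operatorname{link}\sigma$ given by $w\mapsto[\lambda(w)]\in R^N/\langle\lambda(u):u\in\sigma\rangle$. For $J=(j_1,\dots,j_m)\in\mathbb Z_{>0}^m$, $K(J)$ is the complex on vertices $\{i_k:1\le i\le m,1\le k\le j_i\}$ whose minimal non-faces are $\bigcup_{i\in\tau}\{i_1,\dots,i_{j_i}\}$ for $\tau$ a minimal non-face of $K$; $\operatorname{wed}_vK=K(J)$ with $j_v=2$, other $j_i=1$. $I(J)=\{\boldsymbol\alpha:1\le\alpha_i\le j_i\}$; $\sigma(\boldsymbol\alpha)$ is the set of all vertices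 of $K(J)$ except $1_{\alpha_1},\dots,m_{\alpha_m}$, a face whose link is identified with $K$ via $i_{\alpha_i}\mapsto i$. The pre-diagram $D'(K)$: vertices are D-J classes of $R$-characteristic maps over $K$; an edge colored $v$ joins $\lambda_1,\lambda_2$ iff some $R$-characteristic map $\Lambda$ over $\operatorname{wed}_vK$ has $\operatorname{proj}_{v_1}\Lambda=\lambda_1$, $\operatorname{proj}_{v_2}\Lambda=\lambda_2$ (links of $v_1,v_2$ identified with $K$ by sending the other of $v_1,v_2$ to $v$). $G(J)$ is the $1$-skeleton of $\prod_i\Delta^{j_i-1}$ with vertex set $I(J)$, edges joining vertices differing in exactly one coordinate $v$, colored $v$. A puzzle of $(K,J)$ is a color-preserving graph homomorphism $G(J)\to D'(K)$; it is realizable if it equals $\boldsymbol\alpha\mapsto\operatorname{proj}_{\sigma(\boldsymbol\alpha)}\Lambda$ for some $R$-characteristic map $\Lambda$ over $K(J)$. For nonempty $S_i\subseteq[j_i]$, the restriction of a puzzle to the induced subgraph on $\prod_i S_i$, identified with $G(J')$, $j'_i=|S_i|$, via order-preserving bijections, is a subpuzzle (a puzzle of $(K,J')$); it is a subsquare if all $|S_i|\le2$ and exactly two of them equal $2$. *)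

theory Defs
  imports "HOL-Analysis.Analysis"
begin

definition simplicial_complex_on :: "nat set set \<Rightarrow> nat \<Rightarrow> bool" where
  "simplicial_complex_on K m \<longleftrightarrow>
     (\<forall>\<sigma>\<in>K. \<sigma> \<subseteq> {1..m}) \<and> (\<forall>\<sigma>\<in>K. \<forall>\<tau>. \<tau> \<subseteq> \<sigma> \<longrightarrow> \<tau> \<in> K) \<and> (\<forall>i\<in>{1..m}. {i} \<in> K)"

definition star_shaped_sphere :: "nat set set \<Rightarrow> 'n::finite itself \<Rightarrow> bool" where
  "star_shaped_sphere K _ \<longleftrightarrow>
     (\<forall>\<sigma>\<in>K. card \<sigma> \<le> CARD('n)) \<and> (\<exists>\<sigma>\<in>K. card \<sigma> = CARD('n)) \<and>
     (\<exists>x :: nat \<Rightarrow> real^'n.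
        (\<forall>\<sigma>\<in>K. inj_on x \<sigma> \<and> \<not> affine_dependent (x ` \<sigma>)) \<and>
        (\<forall>\<sigma>\<in>K. \<forall>\<tau>\<in>K. convex hull (x ` \<sigma>) \<inter> convex hull (x ` \<tau>) = convex hull (x ` (\<sigma> \<inter> \<tau>))) \<and>
        (\<exists>c. c \<notin> (\<Union>\<sigma>\<in>K. convex hull (x ` \<sigma>)) \<and>
             (\<forall>d. d \<noteq> 0 \<longrightarrow> (\<exists>!t::real. t > 0 \<and> c + t *\<^sub>R d \<in> (\<Union>\<sigma>\<in>K. convex hull (x ` \<sigma>))))))"

definition vec :: "nat \<Rightarrow> (nat \<Rightarrow> 'r::zero) set" where
  "vec N = {x. \<forall>i\<ge>N. x i = 0}"

definition lincomb :: "'v set \<Rightarrow> ('v \<Rightarrow> 'r::comm_ring_1) \<Rightarrow> ('v \<Rightarrow> nat \<Rightarrow> 'r) \<Rightarrow> nat \<Rightarrow> 'r" where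
  "lincomb S c L = (\<lambda>i. \<Sum>u\<in>S. c u * L u i)"

definition is_basis_family :: "nat \<Rightarrow> 'v set \<Rightarrow> ('v \<Rightarrow> nat \<Rightarrow> 'r::comm_ring_1) \<Rightarrow> bool" where
  "is_basis_family N S L \<longleftrightarrow>
     (\<forall>u\<in>S. L u \<in> vec N) \<and> (\<forall>x\<in>vec N. \<exists>!c. c \<in> extensional S \<and> x = lincomb S c L)"

definition char_map :: "'v set set \<Rightarrow> 'v set \<Rightarrow> nat \<Rightarrow> ('v \<Rightarrow> nat \<Rightarrow> 'r::comm_ring_1) \<Rightarrow> bool" where
  "char_map F V N L \<longleftrightarrow>
     (\<forall>v\<in>V. L v \<in> vec N) \<and> (\<forall>v. v \<notin> V \<longrightarrow> L v = (\<lambda>_. 0)) \<and>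
     (\<forall>\<sigma>\<in>F. card \<sigma> = N \<longrightarrow> is_basis_family N \<sigma> L)"

definition mat_apply :: "nat \<Rightarrow> nat \<Rightarrow> (nat \<Rightarrow> nat \<Rightarrow> 'r::comm_ring_1) \<Rightarrow> (nat \<Rightarrow> 'r) \<Rightarrow> nat \<Rightarrow> 'r" where
  "mat_apply p q A x = (\<lambda>i. if i < p then (\<Sum>j<q. A i j * x j) else 0)"

definition GL_mat :: "nat \<Rightarrow> (nat \<Rightarrow> nat \<Rightarrow> 'r::comm_ring_1) \<Rightarrow> bool" where
  "GL_mat N A \<longleftrightarrow> (\<exists>B.
     (\<forall>i<N. \<forall>j<N. (\<Sum>k<N. A i k * B k j) = (if i = j then 1 else 0)) \<and>
     (\<forall>i<N. \<forall>j<N. (\<Sum>k<N. B i k * A k j) = (if i = j then 1 else 0)))"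

definition DJ_equiv :: "'v set \<Rightarrow> nat \<Rightarrow> ('v \<Rightarrow> nat \<Rightarrow> 'r::comm_ring_1) \<Rightarrow> ('v \<Rightarrow> nat \<Rightarrow> 'r) \<Rightarrow> bool" where
  "DJ_equiv V N L1 L2 \<longleftrightarrow> (\<exists>A. GL_mat N A \<and> (\<forall>v\<in>V. L2 v = mat_apply N N A (L1 v)))"

definition min_nonfaces :: "nat set set \<Rightarrow> nat \<Rightarrow> nat set set" where
  "min_nonfaces K m = {\<tau>. \<tau> \<subseteq> {1..m} \<and> \<tau> \<notin> K \<and> (\<forall>i\<in>\<tau>. \<tau> - {i} \<in> K)}"

text \<open>Vertex i_k of K(J) is the pair (i,k).\<close>
definition VJ :: "nat \<Rightarrow> (nat \<Rightarrow> nat) \<Rightarrow> (nat \<times> nat) set" where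
  "VJ m J = {(i, k). i \<in> {1..m} \<and> 1 \<le> k \<and> k \<le> J i}"

definition blowup :: "(nat \<Rightarrow> nat) \<Rightarrow> nat set \<Rightarrow> (nat \<times> nat) set" where
  "blowup J \<tau> = {(i, k). i \<in> \<tau> \<and> 1 \<le> k \<and> k \<le> J i}"

definition KJ :: "nat set set \<Rightarrow> nat \<Rightarrow> (nat \<Rightarrow> nat) \<Rightarrow> (nat \<times> nat) set set" where
  "KJ K m J = {\<sigma>. \<sigma> \<subseteq> VJ m J \<and> (\<forall>\<tau>\<in>min_nonfaces K m. \<not> blowup J \<tau> \<subseteq> \<sigma>)}"

text \<open>Dimension N of the facets of K(J) (K has n-dimensional ambient R^n).\<close>
definition dimJ :: "nat \<Rightarrow> nat \<Rightarrow> (nat \<Rightarrow> nat) \<Rightarrow> nat" where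
  "dimJ m n J = n + (\<Sum>i\<in>{1..m}. J i - 1)"

definition IJ :: "nat \<Rightarrow> (nat \<Rightarrow> nat) \<Rightarrow> (nat \<Rightarrow> nat) set" where
  "IJ m J = {\<alpha>. (\<forall>i\<in>{1..m}. 1 \<le> \<alpha> i \<and> \<alpha> i \<le> J i) \<and> (\<forall>i. i \<notin> {1..m} \<longrightarrow> \<alpha> i = 0)}"

definition sigma_alpha :: "nat \<Rightarrow> (nat \<Rightarrow> nat) \<Rightarrow> (nat \<Rightarrow> nat) \<Rightarrow> (nat \<times> nat) set" where
  "sigma_alpha m J \<alpha> = VJ m J - {(i, \<alpha> i) | i. i \<in> {1..m}}"

definition DJ_class :: "nat set set \<Rightarrow> nat \<Rightarrow> nat \<Rightarrow> (nat \<Rightarrow> nat \<Rightarrow> 'r::comm_ring_1) \<Rightarrow> (nat \<Rightarrow> nat \<Rightarrow> 'r) set" where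
  "DJ_class K m n l = {\<mu>. char_map K {1..m} n \<mu> \<and> DJ_equiv {1..m} n l \<mu>}"

definition DJ_classes :: "nat set set \<Rightarrow> nat \<Rightarrow> nat \<Rightarrow> (nat \<Rightarrow> nat \<Rightarrow> 'r::comm_ring_1) set set" where
  "DJ_classes K m n = {DJ_class K m n l | l. char_map K {1..m} n l}"

text \<open>The D-J class of proj_{sigma(alpha)} L, where L is a characteristic map over K(J) into R^N,
  N = dimJ m n J, with link(sigma(alpha)) identified with K via i_{alpha_i} |-> i.
  A characteristic map lambda over K (into R^n) represents this class iff there is a surjective
  linear map M : R^N -> R^n whose kernel is the span of {L u : u in sigma(alpha)} (so M induces
  an isomorphism R^N / <L u : u in sigma(alpha)> = R^n) with lambda i = M (L (i, alpha i)).\<close>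
definition proj_class :: "nat set set \<Rightarrow> nat \<Rightarrow> nat \<Rightarrow> (nat \<Rightarrow> nat) \<Rightarrow> (nat \<times> nat \<Rightarrow> nat \<Rightarrow> 'r::comm_ring_1)
    \<Rightarrow> (nat \<Rightarrow> nat) \<Rightarrow> (nat \<Rightarrow> nat \<Rightarrow> 'r) set" where
  "proj_class K m n J L \<alpha> =
     {l. char_map K {1..m} n l \<and>
        (\<exists>M. (\<forall>y\<in>vec n. \<exists>x\<in>vec (dimJ m n J). mat_apply n (dimJ m n J) M x = y) \<and>
             {x\<in>vec (dimJ m n J). mat_apply n (dimJ m n J) M x = (\<lambda>_. 0)}
                = {lincomb (sigma_alpha m J \<alpha>) c L | c. True} \<and>
             (\<forall>i\<in>{1..m}. l i = mat_apply n (dimJ m n J) M (L (i, \<alpha> i))))}"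

definition wedgeJ :: "nat \<Rightarrow> nat \<Rightarrow> nat" where
  "wedgeJ v = (\<lambda>i. if i = v then 2 else 1)"

definition wedge_alpha :: "nat \<Rightarrow> nat \<Rightarrow> nat \<Rightarrow> nat \<Rightarrow> nat" where
  "wedge_alpha m v a = (\<lambda>i. if i \<in> {1..m} then (if i = v then a else 1) else 0)"

text \<open>Edge of colour v of D'(K) from class c1 to class c2: some characteristic map L over
  wed_v K with proj_{v_1} L = c1 and proj_{v_2} L = c2. Here sigma = {v_1} corresponds to
  alpha_v = 2 and sigma = {v_2} to alpha_v = 1.\<close>
definition D_edge_dir :: "nat set set \<Rightarrow> nat \<Rightarrow> nat \<Rightarrow> 'r::comm_ring_1 itself \<Rightarrow> nat
    \<Rightarrow> (nat \<Rightarrow> nat \<Rightarrow> 'r) set \<Rightarrow> (nat \<Rightarrow> nat \<Rightarrow> 'r) set \<Rightarrow> bool" where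
  "D_edge_dir K m n _ v c1 c2 \<longleftrightarrow>
     (\<exists>L :: nat \<times> nat \<Rightarrow> nat \<Rightarrow> 'r.
        char_map (KJ K m (wedgeJ v)) (VJ m (wedgeJ v)) (dimJ m n (wedgeJ v)) L \<and>
        c1 = proj_class K m n (wedgeJ v) L (wedge_alpha m v 2) \<and>
        c2 = proj_class K m n (wedgeJ v) L (wedge_alpha m v 1))"

definition D_edge :: "nat set set \<Rightarrow> nat \<Rightarrow> nat \<Rightarrow> nat
    \<Rightarrow> (nat \<Rightarrow> nat \<Rightarrow> 'r::comm_ring_1) set \<Rightarrow> (nat \<Rightarrow> nat \<Rightarrow> 'r) set \<Rightarrow> bool" where
  "D_edge K m n v c1 c2 \<longleftrightarrow> D_edge_dir K m n TYPE('r) v c1 c2 \<or> D_edge_dir K m n TYPE('r) v c2 c1"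

text \<open>Puzzle of (K,J): colour-preserving graph homomorphism G(J) -> D'(K).\<close>
definition is_puzzle :: "nat set set \<Rightarrow> nat \<Rightarrow> nat \<Rightarrow> (nat \<Rightarrow> nat)
    \<Rightarrow> ((nat \<Rightarrow> nat) \<Rightarrow> (nat \<Rightarrow> nat \<Rightarrow> 'r::comm_ring_1) set) \<Rightarrow> bool" where
  "is_puzzle K m n J p \<longleftrightarrow>
     (\<forall>\<alpha>\<in>IJ m J. p \<alpha> \<in> DJ_classes K m n) \<and>
     (\<forall>\<alpha>\<in>IJ m J. \<forall>\<beta>\<in>IJ m J. \<forall>v\<in>{1..m}.
        (\<alpha> v \<noteq> \<beta> v \<and> (\<forall>i. i \<noteq> v \<longrightarrow> \<alpha> i = \<beta> i)) \<longrightarrow> D_edge K m n v (p \<alpha>) (p \<beta>))"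

definition realizable :: "nat set set \<Rightarrow> nat \<Rightarrow> nat \<Rightarrow> (nat \<Rightarrow> nat)
    \<Rightarrow> ((nat \<Rightarrow> nat) \<Rightarrow> (nat \<Rightarrow> nat \<Rightarrow> 'r::comm_ring_1) set) \<Rightarrow> bool" where
  "realizable K m n J p \<longleftrightarrow>
     (\<exists>L. char_map (KJ K m J) (VJ m J) (dimJ m n J) L \<and>
          (\<forall>\<alpha>\<in>IJ m J. p \<alpha> = proj_class K m n J L \<alpha>))"

definition puzzle_of :: "nat set set \<Rightarrow> nat \<Rightarrow> nat \<Rightarrow> (nat \<Rightarrow> nat)
    \<Rightarrow> (nat \<times> nat \<Rightarrow> nat \<Rightarrow> 'r::comm_ring_1) \<Rightarrow> (nat \<Rightarrow> nat) \<Rightarrow> (nat \<Rightarrow> nat \<Rightarrow> 'r) set" where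
  "puzzle_of K m n J L = restrict (\<lambda>\<alpha>. proj_class K m n J L \<alpha>) (IJ m J)"

definition valid_sel :: "nat \<Rightarrow> (nat \<Rightarrow> nat) \<Rightarrow> (nat \<Rightarrow> nat set) \<Rightarrow> bool" where
  "valid_sel m J S \<longleftrightarrow> (\<forall>i\<in>{1..m}. S i \<noteq> {} \<and> S i \<subseteq> {1..J i})"

definition sel_J :: "(nat \<Rightarrow> nat set) \<Rightarrow> nat \<Rightarrow> nat" where
  "sel_J S = (\<lambda>i. card (S i))"

text \<open>Restriction of p to prod_i S_i, re-indexed by G(J') via the order-preserving bijections
  [J'_i] -> S_i, k |-> k-th smallest element of S_i.\<close>
definition subpuzzle :: "nat \<Rightarrow> (nat \<Rightarrow> nat set) \<Rightarrow> ((nat \<Rightarrow> nat) \<Rightarrow> 'a) \<Rightarrow> (nat \<Rightarrow> nat) \<Rightarrow> 'a" where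
  "subpuzzle m S p = (\<lambda>\<alpha>'. p (\<lambda>i. if i \<in> {1..m} then sorted_list_of_set (S i) ! (\<alpha>' i - 1) else 0))"

definition is_subsquare_sel :: "nat \<Rightarrow> (nat \<Rightarrow> nat) \<Rightarrow> (nat \<Rightarrow> nat set) \<Rightarrow> bool" where
  "is_subsquare_sel m J S \<longleftrightarrow> valid_sel m J S \<and>
     (\<forall>i\<in>{1..m}. card (S i) \<le> 2) \<and> card {i\<in>{1..m}. card (S i) = 2} = 2"

definition all_subsquares_realizable :: "nat set set \<Rightarrow> nat \<Rightarrow> nat \<Rightarrow> (nat \<Rightarrow> nat)
    \<Rightarrow> ((nat \<Rightarrow> nat) \<Rightarrow> (nat \<Rightarrow> nat \<Rightarrow> 'r::comm_ring_1) set) \<Rightarrow> bool" where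
  "all_subsquares_realizable K m n J p \<longleftrightarrow>
     (\<forall>S. is_subsquare_sel m J S \<longrightarrow> realizable K m n (sel_J S) (subpuzzle m S p))"

end

theory Submission
  imports Defs
begin

text \<open>
  A characteristic map \<open>L\<close> on a vertex set \<open>V\<close> is determined up to D-J equivalence by its module of
  linear relations \<open>P = {x. (\<Sum>v\<in>V. x v * L v) = 0}\<close>, and \<open>L\<close> is a basis on \<open>\<sigma>\<close> iff the coordinates off
  \<open>\<sigma>\<close> parametrise \<open>P\<close>. Passing to the projection at \<open>\<alpha>\<close> becomes pulling relations back along
  \<open>i \<mapsto> (i, \<alpha> i)\<close>, and the facets of \<open>K(J)\<close> are the complements of partial sections
  \<open>{(i, \<alpha> i). i \<notin> \<tau>}\<close> with \<open>\<tau>\<close> a facet of \<open>K\<close>.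

  A puzzle is thus a family of modules \<open>A \<alpha>\<close> of functions on the vertices of \<open>K\<close>, and a realization is
  a module of functions on the vertices of \<open>K(J)\<close> pulling back onto every \<open>A \<alpha>\<close>; the only candidate is
  the module of all functions whose pullback along each \<open>\<alpha>\<close> lies in \<open>A \<alpha>\<close>. Every vertex lies in a
  facet, so an element of \<open>A \<alpha>\<close> is determined by its values off any single vertex. Hence edges of the
  puzzle extend an element of \<open>A base\<close> to a unique function on the vertices of \<open>K(J)\<close>, and the realizable
  squares show, by induction on the number of coordinates in which \<open>\<alpha>\<close> differs from \<open>base\<close>, that its
  pullbacks lie in all \<open>A \<alpha>\<close>.
\<close>

section \<open>Relation modules of characteristic maps\<close>

definition supported_on :: "'v set \<Rightarrow> ('v \<Rightarrow> 'r::zero) set" where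
  "supported_on V = {x. \<forall>v. v \<notin> V \<longrightarrow> x v = 0}"

text \<open>The kernel of the map from R^V to R^N given by \<open>L\<close>, that is, its linear
  Gale dual. Elements vanish off \<open>V\<close>, so that equality of functions means equality on
  \<open>V\<close>.\<close>

definition relations :: "'v set \<Rightarrow> ('v \<Rightarrow> nat \<Rightarrow> 'r::comm_ring_1) \<Rightarrow> ('v \<Rightarrow> 'r) set" where
  "relations V L = {x \<in> supported_on V. lincomb V x L = (\<lambda>_. 0)}"

definition submodule :: "('v \<Rightarrow> 'r::comm_ring_1) set \<Rightarrow> bool" where
  "submodule P \<longleftrightarrow> (\<lambda>_. 0) \<in> P \<and> (\<forall>x\<in>P. \<forall>y\<in>P. (\<lambda>v. x v + y v) \<in> P)
     \<and> (\<forall>a. \<forall>x\<in>P. (\<lambda>v. a * x v) \<in> P)"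

text \<open>For a submodule, this makes restriction to \<open>V - S\<close> a bijection from
  \<open>P\<close> onto all functions on \<open>V - S\<close>; injectivity is expressed through the
  kernel. It is the dual of \<open>S\<close> being a basis.\<close>

definition chart :: "'v set \<Rightarrow> 'v set \<Rightarrow> ('v \<Rightarrow> 'r::comm_ring_1) set \<Rightarrow> bool" where
  "chart V S P \<longleftrightarrow> (\<forall>y. \<exists>x\<in>P. \<forall>v\<in>V - S. x v = y v)
     \<and> (\<forall>x\<in>P. (\<forall>v\<in>V - S. x v = 0) \<longrightarrow> x = (\<lambda>_. 0))"

text \<open>The dual counterpart of \<open>char_map\<close>. No coordinates of R^N enter, which is
  why such modules stand for D-J classes rather than for single maps.\<close>

definition char_relations ::
  "'v set set \<Rightarrow> 'v set \<Rightarrow> nat \<Rightarrow> ('v \<Rightarrow> 'r::comm_ring_1) set \<Rightarrow> bool" where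
  "char_relations F V N P \<longleftrightarrow> submodule P \<and> P \<subseteq> supported_on V
     \<and> (\<forall>\<sigma>\<in>F. card \<sigma> = N \<longrightarrow> chart V \<sigma> P)"

lemma submodule_add: "submodule P \<Longrightarrow> x \<in> P \<Longrightarrow> y \<in> P \<Longrightarrow> (\<lambda>v. x v + y v) \<in> P"
  by (simp add: submodule_def)

lemma submodule_scale: "submodule P \<Longrightarrow> x \<in> P \<Longrightarrow> (\<lambda>v. a * x v) \<in> P"
  by (simp add: submodule_def)

lemma submodule_diff:
  assumes "submodule P" "x \<in> P" "y \<in> P"
  shows "(\<lambda>v. x v - y v) \<in> P"
  using submodule_add[OF assms(1,2) submodule_scale[OF assms(1,3), of "- 1"]] by simp

lemma submodule_sum:
  assumes "submodule P" "finite A" "\<And>a. a \<in> A \<Longrightarrow> f a \<in> P"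
  shows "(\<lambda>v. \<Sum>a\<in>A. c a * f a v) \<in> P"
  using assms(2,3)
proof (induction A rule: finite_induct)
  case empty
  then show ?case using assms(1) by (simp add: submodule_def)
next
  case (insert a A)
  have "(\<lambda>v. c a * f a v + (\<Sum>a\<in>A. c a * f a v)) \<in> P"
    using insert by (intro submodule_add submodule_scale assms(1)) auto
  then show ?case using insert by simp
qed

lemma chart_extend:
  assumes "chart V S P"
  obtains x where "x \<in> P" "\<And>v. v \<in> V - S \<Longrightarrow> x v = y v"
proof -
  have "\<exists>x\<in>P. \<forall>v\<in>V - S. x v = y v" using assms unfolding chart_def by simp
  then show ?thesis using that by auto
qed

lemma chart_unique:
  assumes "chart V S P" "x \<in> P" "\<And>v. v \<in> V - S \<Longrightarrow> x v = 0"
  shows "x = (\<lambda>_. 0)"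
  using assms unfolding chart_def by simp

lemma lincomb_add: "lincomb S (\<lambda>v. c v + d v) L = (\<lambda>i. lincomb S c L i + lincomb S d L i)"
  by (simp add: lincomb_def distrib_right sum.distrib)

lemma lincomb_diff: "lincomb S (\<lambda>v. c v - d v) L = (\<lambda>i. lincomb S c L i - lincomb S d L i)"
  by (simp add: lincomb_def left_diff_distrib sum_subtractf)

lemma lincomb_scale: "lincomb S (\<lambda>v. a * c v) L = (\<lambda>i. a * lincomb S c L i)"
  by (simp add: lincomb_def sum_distrib_left mult.assoc)

lemma lincomb_cong:
  assumes "\<And>v. v \<in> S \<Longrightarrow> c v = d v" and "\<And>v. v \<in> S \<Longrightarrow> L v = M v"
  shows "lincomb S c L = lincomb S d M"
  unfolding lincomb_def using assms by (intro ext sum.cong) auto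

lemma lincomb_mono_neutral:
  assumes "finite V" "S \<subseteq> V" "\<And>v. v \<in> V - S \<Longrightarrow> c v = 0"
  shows "lincomb V c L = lincomb S c L"
  unfolding lincomb_def using assms by (intro ext sum.mono_neutral_right) auto

lemma lincomb_in_vec:
  assumes "\<And>v. v \<in> S \<Longrightarrow> L v \<in> vec N"
  shows "lincomb S c L \<in> vec N"
  using assms by (auto simp: vec_def lincomb_def)

lemma submodule_relations: "submodule (relations V L)"
  unfolding submodule_def relations_def supported_on_def
  by (auto simp: lincomb_add lincomb_scale) (simp add: lincomb_def)

text \<open>Evaluating \<open>L\<close> on the unit function at \<open>v\<close> minus
  \<open>c\<close> extended by zero gives \<open>L v\<close> minus its proposed expansion. This
  moves expansions between families that share their relations.\<close>

lemma expansion_iff_relation: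
  assumes V: "finite V" and S: "S \<subseteq> V" and v: "v \<in> V"
  shows "L v = lincomb S c L \<longleftrightarrow>
    (\<lambda>u. (if u = v then 1 else 0) - (if u \<in> S then c u else 0)) \<in> relations V L"
    (is "_ \<longleftrightarrow> ?x \<in> _")
proof -
  have "lincomb V ?x L i = L v i - lincomb S c L i" for i
  proof -
    have "lincomb V ?x L i = lincomb V (\<lambda>u. if u = v then 1 else 0) L i
        - lincomb V (\<lambda>u. if u \<in> S then c u else 0) L i"
      unfolding lincomb_diff ..
    also have "lincomb V (\<lambda>u. if u = v then 1 else 0) L i = (\<Sum>u\<in>V. if u = v then L u i else 0)"
      unfolding lincomb_def by (intro sum.cong) auto
    also have "\<dots> = L v i" using V v by simp
    also have "lincomb V (\<lambda>u. if u \<in> S then c u else 0) L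
        = lincomb S (\<lambda>u. if u \<in> S then c u else 0) L"
      using V S by (intro lincomb_mono_neutral) auto
    also have "\<dots> = lincomb S c L" by (intro lincomb_cong) auto
    finally show ?thesis .
  qed
  moreover have "?x \<in> supported_on V" using v S by (auto simp: supported_on_def)
  ultimately show ?thesis by (simp add: relations_def fun_eq_iff)
qed

section \<open>Bases and charts\<close>

text \<open>Unique existence among \<open>extensional\<close> coefficients splits into spanning and
  independence with unconstrained coefficients: \<open>restrict\<close> normalises any coefficient
  function without changing its combination.\<close>

lemma is_basis_family_iff:
  "is_basis_family N S L \<longleftrightarrow> (\<forall>u\<in>S. L u \<in> vec N) \<and> (\<forall>x\<in>vec N. \<exists>c. x = lincomb S c L)
     \<and> (\<forall>c. lincomb S c L = (\<lambda>_. 0) \<longrightarrow> (\<forall>u\<in>S. c u = 0))" (is "?L \<longleftrightarrow> ?A \<and> ?B \<and> ?C")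
proof
  assume l: ?L
  then have A: ?A by (simp add: is_basis_family_def)
  have B: ?B using l unfolding is_basis_family_def by blast
  have z: "(\<lambda>_. 0) \<in> (vec N :: (nat \<Rightarrow> 'b) set)" by (simp add: vec_def)
  have C: ?C
  proof (intro allI impI)
    fix c assume c: "lincomb S c L = (\<lambda>_. 0)"
    have 1: "(\<lambda>_. 0) = lincomb S (restrict c S) L"
      using c lincomb_cong[of S "restrict c S" c L L] by simp
    have 2: "(\<lambda>_. 0) = lincomb S (restrict (\<lambda>_. 0) S) L"
      using lincomb_cong[of S "restrict (\<lambda>_. 0) S" "\<lambda>_. 0" L L] by (simp add: lincomb_def)
    from l z have "\<exists>!c. c \<in> extensional S \<and> (\<lambda>_. 0) = lincomb S c L"
      by (auto simp: is_basis_family_def)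
    then have "restrict c S = restrict (\<lambda>_. 0) S"
      using 1 2 restrict_extensional by blast
    then show "\<forall>u\<in>S. c u = 0" by (metis restrict_apply')
  qed
  show "?A \<and> ?B \<and> ?C" using A B C by blast
next
  assume r: "?A \<and> ?B \<and> ?C"
  then have B: ?B and C: "\<And>c. lincomb S c L = (\<lambda>_. 0) \<Longrightarrow> \<forall>u\<in>S. c u = 0" by simp_all
  have "\<exists>!c. c \<in> extensional S \<and> x = lincomb S c L" if x: "x \<in> vec N" for x
  proof -
    obtain c where c: "x = lincomb S c L" using bspec[OF B x] by (elim exE)
    show ?thesis
    proof (rule ex1I[of _ "restrict c S"])
      show "restrict c S \<in> extensional S \<and> x = lincomb S (restrict c S) L"
        using c lincomb_cong[of S "restrict c S" c L L] by simp
    next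
      fix d assume d: "d \<in> extensional S \<and> x = lincomb S d L"
      have "lincomb S (\<lambda>v. d v - c v) L = (\<lambda>_. 0)"
        using c d by (simp add: lincomb_diff)
      then have "\<forall>u\<in>S. d u - c u = 0" by (rule C)
      then show "d = restrict c S"
        using d by (intro extensionalityI[of _ S]) auto
    qed
  qed
  then show ?L using r by (simp add: is_basis_family_def)
qed

lemma basis_expansion:
  assumes "is_basis_family N S L" "x \<in> vec N"
  obtains c where "x = lincomb S c L"
  using assms by (auto simp: is_basis_family_iff)

lemma basis_independent:
  assumes "is_basis_family N S L" "lincomb S c L = (\<lambda>_. 0)"
  shows "\<forall>u\<in>S. c u = 0"
  using assms by (simp add: is_basis_family_iff)

text \<open>Prescribed values off \<open>S\<close> give a vector, and its expansion in the basis
  \<open>S\<close>, negated, supplies the values on \<open>S\<close>. A relation vanishing off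
  \<open>S\<close> is a dependence of the basis, hence zero.\<close>

lemma chart_relations:
  assumes V: "finite V" "S \<subseteq> V" and L: "\<And>v. v \<in> V \<Longrightarrow> L v \<in> vec N"
    and b: "is_basis_family N S L"
  shows "chart V S (relations V L)"
  unfolding chart_def
proof (intro conjI allI ballI impI)
  fix y
  have "lincomb (V - S) y L \<in> vec N" using L by (intro lincomb_in_vec) auto
  then obtain c where c: "lincomb (V - S) y L = lincomb S c L"
    using b unfolding is_basis_family_iff by metis
  define x where "x = (\<lambda>v. if v \<in> S then - c v else if v \<in> V then y v else 0)"
  have "lincomb V x L i = 0" for i
  proof -
    have "lincomb V x L i = (\<Sum>v\<in>V - S. x v * L v i) + (\<Sum>v\<in>S. x v * L v i)"
      unfolding lincomb_def using V by (simp add: sum.subset_diff)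
    also have "\<dots> = lincomb (V - S) y L i - lincomb S c L i"
      unfolding lincomb_def x_def by (simp add: sum_negf)
    finally show ?thesis using c by simp
  qed
  then have "x \<in> relations V L"
    unfolding relations_def supported_on_def x_def using V(2) by auto
  moreover have "\<forall>v\<in>V - S. x v = y v" by (auto simp: x_def)
  ultimately show "\<exists>x\<in>relations V L. \<forall>v\<in>V - S. x v = y v" by blast
next
  fix x assume x: "x \<in> relations V L" and 0: "\<forall>v\<in>V - S. x v = 0"
  have "lincomb S x L = (\<lambda>_. 0)"
    using x lincomb_mono_neutral[OF V] 0 by (metis (mono_tags, lifting) mem_Collect_eq relations_def)
  then have "\<forall>u\<in>S. x u = 0" using b by (simp add: is_basis_family_iff)
  then show "x = (\<lambda>_. 0)" using x 0 by (auto simp: relations_def supported_on_def)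
qed

text \<open>Subtracting a relation that agrees with \<open>c\<close> off \<open>S\<close> clears the
  coefficients off \<open>S\<close>, so \<open>S\<close> spans whatever \<open>V\<close> spans.
  Relations cannot see vectors outside the span of \<open>L\<close>, hence the hypothesis
  \<open>span\<close>. A dependence on \<open>S\<close>, extended by zero, is a relation vanishing
  off \<open>S\<close>.\<close>

lemma is_basis_family_of_chart:
  assumes V: "finite V" "S \<subseteq> V" and L: "\<And>v. v \<in> V \<Longrightarrow> L v \<in> vec N"
    and span: "\<And>z. z \<in> vec N \<Longrightarrow> \<exists>c. z = lincomb V c L"
    and ch: "chart V S (relations V L)"
  shows "is_basis_family N S L"
  unfolding is_basis_family_iff
proof (intro conjI ballI allI impI)
  fix u assume "u \<in> S" then show "L u \<in> vec N" using V L by auto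
next
  fix z :: "nat \<Rightarrow> 'b" assume "z \<in> vec N"
  then obtain c where c: "z = lincomb V c L" using span by blast
  obtain x where x: "x \<in> relations V L" "\<And>v. v \<in> V - S \<Longrightarrow> x v = c v"
    using chart_extend[OF ch, of c] by blast
  have "z = lincomb V (\<lambda>v. c v - x v) L"
    using c x(1) by (simp add: lincomb_diff relations_def)
  also have "\<dots> = lincomb S (\<lambda>v. c v - x v) L"
    using x(2) by (intro lincomb_mono_neutral[OF V]) auto
  finally show "\<exists>c. z = lincomb S c L" by blast
next
  fix c u assume c: "lincomb S c L = (\<lambda>_. 0)" and u: "u \<in> S"
  define x where "x = (\<lambda>v. if v \<in> S then c v else 0)"
  have "lincomb V x L = lincomb S x L"
    by (intro lincomb_mono_neutral[OF V]) (auto simp: x_def)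
  also have "\<dots> = lincomb S c L" by (intro lincomb_cong) (auto simp: x_def)
  finally have "x \<in> relations V L"
    using c V(2) by (auto simp: relations_def supported_on_def x_def)
  moreover have "\<forall>v\<in>V - S. x v = 0" by (simp add: x_def)
  ultimately have "x = (\<lambda>_. 0)" using ch by (simp add: chart_def)
  then show "c u = 0" using u by (metis x_def)
qed

text \<open>Realizes the quotient of R^V by \<open>P\<close>: the chart makes R^S a complement of
  \<open>P\<close>, and numbering \<open>S\<close> by \<open>b\<close> identifies R^S with R^N. The
  family consists of the images of the unit functions.\<close>

lemma exists_family_with_relations:
  assumes V: "finite V" "S \<subseteq> V" "card S = N"
    and P: "submodule P" "P \<subseteq> supported_on V" and ch: "chart V S P"
  obtains L :: "'v \<Rightarrow> nat \<Rightarrow> 'r::comm_ring_1"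
  where "\<And>v. L v \<in> vec N" "\<And>v. v \<notin> V \<Longrightarrow> L v = (\<lambda>_. 0)" "relations V L = P"
    "\<And>z. z \<in> vec N \<Longrightarrow> \<exists>c. z = lincomb V c L"
proof -
  have fS: "finite S" using V finite_subset by blast
  obtain b where b: "bij_betw b {..<N} S"
    using ex_bij_betw_nat_finite[OF fS] V(3) by (auto simp: lessThan_atLeast0)
  have bS: "b i \<in> S" if "i < N" for i using b that by (auto simp: bij_betw_def)
  have "\<exists>x. x \<in> P \<and> (\<forall>v\<in>V - S. x v = (if v = w then 1 else 0))" for w
    using chart_extend[OF ch, of "\<lambda>v. if v = w then 1 else 0"] by metis
  then obtain f where f: "\<And>w. f w \<in> P" "\<And>w v. v \<in> V - S \<Longrightarrow> f w v = (if v = w then 1 else 0)"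
    by metis
  \<comment> \<open>\<open>f w\<close> reads as the relation \<open>w + (\<Sum>u\<in>S. f w u * u) = 0\<close>, which forces \<open>L w\<close>.\<close>
  define L where "L = (\<lambda>v i. if i < N \<and> v \<in> V then
      (if v \<in> S then (if v = b i then 1 else 0) else - f v (b i)) else 0)"
  have comb: "lincomb V x L i = x (b i) - (\<Sum>v\<in>V - S. x v * f v (b i))" if i: "i < N" for x i
  proof -
    have "lincomb V x L i = (\<Sum>v\<in>V - S. x v * L v i) + (\<Sum>v\<in>S. x v * L v i)"
      unfolding lincomb_def using V by (simp add: sum.subset_diff)
    also have "(\<Sum>v\<in>V - S. x v * L v i) = - (\<Sum>v\<in>V - S. x v * f v (b i))"
      using i by (simp add: L_def sum_negf)
    also have "(\<Sum>v\<in>S. x v * L v i) = (\<Sum>v\<in>S. if v = b i then x v else 0)"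
      using i V(2) by (intro sum.cong) (auto simp: L_def)
    also have "\<dots> = x (b i)" using fS bS[OF i] by simp
    finally show ?thesis by simp
  qed
  have comb0: "lincomb V x L i = 0" if "\<not> i < N" for x i
    using that by (simp add: lincomb_def L_def)
  have relP: "relations V L = P"
  proof (intro set_eqI iffI)
    fix x assume x: "x \<in> relations V L"
    \<comment> \<open>\<open>y\<close> is the element of \<open>P\<close> with the values of
      \<open>x\<close> off \<open>S\<close>. The vanishing of the combination, read at index
      \<open>i\<close>, says that \<open>x\<close> and \<open>y\<close> also agree at
      \<open>b i\<close>.\<close>
    define y where "y = (\<lambda>u. \<Sum>v\<in>V - S. x v * f v u)"
    have yP: "y \<in> P" unfolding y_def using f(1) V by (intro submodule_sum[OF P(1)]) auto
    have "x u = y u" for u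
    proof -
      consider "u \<notin> V" | "u \<in> V - S" | "u \<in> S" using V by blast
      then show ?thesis
      proof cases
        case 1 then show ?thesis using x yP P(2) by (auto simp: relations_def supported_on_def)
      next
        case 2
        have "y u = (\<Sum>v\<in>V - S. if u = v then x v else 0)"
          unfolding y_def using 2 f(2) by (intro sum.cong) auto
        then show ?thesis using 2 V by simp
      next
        case 3
        then obtain i where i: "i < N" "u = b i" using b by (auto simp: bij_betw_def)
        have "lincomb V x L i = 0" using x by (simp add: relations_def)
        then show ?thesis using comb[OF i(1)] i(2) y_def by simp
      qed
    qed
    then show "x \<in> P" using yP by presburger
  next
    fix x assume x: "x \<in> P"
    \<comment> \<open>The same comparison element; now \<open>x\<close> lies in \<open>P\<close>, so
      uniqueness in the chart gives \<open>x = y\<close>, and the values at \<open>b i\<close> yield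
      the relation.\<close>
    define y where "y = (\<lambda>u. \<Sum>v\<in>V - S. x v * f v u)"
    have yP: "y \<in> P" unfolding y_def using f(1) V by (intro submodule_sum[OF P(1)]) auto
    have "x u - y u = 0" if "u \<in> V - S" for u
    proof -
      have "y u = (\<Sum>v\<in>V - S. if u = v then x v else 0)"
        unfolding y_def using that f(2) by (intro sum.cong) auto
      then show ?thesis using that V by simp
    qed
    then have "(\<lambda>u. x u - y u) = (\<lambda>_. 0)"
      by (intro chart_unique[OF ch submodule_diff[OF P(1) x yP]])
    then have "x u - y u = 0" for u by (rule fun_cong)
    then have "x (b i) - y (b i) = 0" for i .
    then have "lincomb V x L i = 0" for i
      using comb[of i x] comb0[of i x] unfolding y_def by (cases "i < N") simp_all
    then show "x \<in> relations V L" using x P(2) by (auto simp: relations_def)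
  qed
  have "\<exists>c. z = lincomb V c L" if z: "z \<in> vec N" for z
  proof -
    define c where "c = (\<lambda>v. if v \<in> S then z (the_inv_into {..<N} b v) else 0)"
    have "c (b i) = z i" if "i < N" for i
      using that bS b by (simp add: c_def bij_betw_def the_inv_into_f_f)
    moreover have "(\<Sum>v\<in>V - S. c v * f v (b i)) = 0" for i
      by (intro sum.neutral) (simp add: c_def)
    ultimately have "lincomb V c L i = z i" for i
      using comb[of i c] comb0[of i c] z by (cases "i < N") (auto simp: vec_def)
    then show ?thesis by (intro exI[of _ c]) auto
  qed
  then show ?thesis using relP that[of L] by (auto simp: L_def vec_def)
qed

lemma char_relations_of_char_map:
  assumes "finite V" "\<And>\<sigma>. \<sigma> \<in> F \<Longrightarrow> \<sigma> \<subseteq> V" "char_map F V N L"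
  shows "char_relations F V N (relations V L)"
  unfolding char_relations_def
proof (intro conjI ballI impI submodule_relations)
  show "relations V L \<subseteq> supported_on V" by (auto simp: relations_def)
  fix \<sigma> assume "\<sigma> \<in> F" "card \<sigma> = N"
  then show "chart V \<sigma> (relations V L)"
    using assms by (intro chart_relations[of V \<sigma> L N]) (auto simp: char_map_def)
qed

text \<open>One facet is enough to build the family and to make it span R^N; the charts of the
  remaining facets then turn into bases.\<close>

lemma exists_char_map:
  assumes V: "finite V" "\<And>\<sigma>. \<sigma> \<in> F \<Longrightarrow> \<sigma> \<subseteq> V" and F: "\<tau> \<in> F" "card \<tau> = N"
    and P: "char_relations F V N P"
  obtains L where "char_map F V N L" "relations V L = P"
proof -
  obtain L where L: "\<And>v. L v \<in> vec N" "\<And>v. v \<notin> V \<Longrightarrow> L v = (\<lambda>_. 0)" "relations V L = P"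
    "\<And>z. z \<in> vec N \<Longrightarrow> \<exists>c. z = lincomb V c L"
    using exists_family_with_relations[of V \<tau> N P] V F P unfolding char_relations_def by blast
  have "is_basis_family N \<sigma> L" if "\<sigma> \<in> F" "card \<sigma> = N" for \<sigma>
    using that V L P by (intro is_basis_family_of_chart[of V]) (auto simp: char_relations_def)
  then show ?thesis using that[of L] L by (auto simp: char_map_def)
qed

section \<open>Matrices, and D-J equivalence as equality of relation modules\<close>

lemma mat_apply_lincomb:
  "mat_apply p q A (lincomb S c L) = lincomb S c (\<lambda>u. mat_apply p q A (L u))"
proof
  fix i
  have "(\<Sum>j<q. A i j * (\<Sum>u\<in>S. c u * L u j)) = (\<Sum>u\<in>S. c u * (\<Sum>j<q. A i j * L u j))"
    unfolding sum_distrib_left by (subst sum.swap) (simp add: mult_ac)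
  then show "mat_apply p q A (lincomb S c L) i = lincomb S c (\<lambda>u. mat_apply p q A (L u)) i"
    by (simp add: mat_apply_def lincomb_def)
qed

lemma mat_apply_mult:
  "mat_apply N N A (mat_apply N N B x) = mat_apply N N (\<lambda>i j. \<Sum>k<N. A i k * B k j) x"
proof
  fix i
  have "(\<Sum>j<N. A i j * (\<Sum>k<N. B j k * x k)) = (\<Sum>k<N. (\<Sum>j<N. A i j * B j k) * x k)"
    unfolding sum_distrib_left sum_distrib_right by (subst sum.swap) (simp add: mult_ac)
  then show "mat_apply N N A (mat_apply N N B x) i
      = mat_apply N N (\<lambda>i j. \<Sum>k<N. A i k * B k j) x i"
    by (simp add: mat_apply_def)
qed

lemma mat_apply_unit:
  assumes "j < N" "i < p"
  shows "mat_apply p N A (\<lambda>k. if k = j then 1 else 0) i = A i j"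
  using assms by (simp add: mat_apply_def if_distrib[of "\<lambda>x. _ * x"] cong: if_cong)

lemma mat_apply_identity:
  assumes "\<forall>i<N. \<forall>j<N. A i j = (if i = j then 1 else 0)" "x \<in> vec N"
  shows "mat_apply N N A x = x"
proof
  fix i
  have "(\<Sum>j<N. A i j * x j) = (\<Sum>j<N. if i = j then x j else 0)" if "i < N"
    using that assms(1) by (intro sum.cong) auto
  then show "mat_apply N N A x i = x i"
    using assms(2) by (auto simp: mat_apply_def vec_def)
qed

text \<open>Column \<open>j\<close> of \<open>A\<close> is obtained by expanding the
  \<open>j\<close>-th unit vector in the basis \<open>L\<close> and replacing each
  \<open>L u\<close> by \<open>T u\<close>.\<close>

lemma exists_mat_on_basis:
  assumes S: "finite S" and b: "is_basis_family N S L" and T: "\<And>u. u \<in> S \<Longrightarrow> T u \<in> vec p"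
  obtains A where "\<And>u. u \<in> S \<Longrightarrow> mat_apply p N A (L u) = T u"
proof -
  define e :: "nat \<Rightarrow> nat \<Rightarrow> 'b" where "e = (\<lambda>j k. if k = j then 1 else 0)"
  have "e j \<in> vec N" if "j < N" for j using that by (auto simp: e_def vec_def)
  then have "\<forall>j. \<exists>c. j < N \<longrightarrow> e j = lincomb S c L"
    using b by (simp add: is_basis_family_iff)
  then obtain c where c: "\<And>j. j < N \<Longrightarrow> e j = lincomb S (c j) L" by metis
  define A where "A = (\<lambda>i j. \<Sum>u\<in>S. c j u * T u i)"
  have "mat_apply p N A (L w) = T w" if w: "w \<in> S" for w
  proof -
    have Lw: "L w \<in> vec N" using b w by (simp add: is_basis_family_iff)
    \<comment> \<open>\<open>d\<close> compares two expansions of \<open>L w\<close> in the basis: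
      the one through unit vectors and the trivial one. Independence makes them equal.\<close>
    define d where "d = (\<lambda>u. (\<Sum>j<N. L w j * c j u) - (if u = w then 1 else 0))"
    have "lincomb S d L i = 0" for i
    proof -
      have "lincomb S (\<lambda>u. \<Sum>j<N. L w j * c j u) L i = (\<Sum>j<N. L w j * lincomb S (c j) L i)"
        unfolding lincomb_def sum_distrib_left sum_distrib_right
        by (subst sum.swap) (simp add: mult_ac)
      also have "\<dots> = (\<Sum>j<N. L w j * e j i)" using c by (intro sum.cong) auto
      also have "\<dots> = (\<Sum>j<N. if i = j then L w j else 0)" by (intro sum.cong) (auto simp: e_def)
      also have "\<dots> = L w i" using Lw by (auto simp: vec_def)
      finally have 1: "lincomb S (\<lambda>u. \<Sum>j<N. L w j * c j u) L i = L w i" .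
      have "lincomb S (\<lambda>u. if u = w then 1 else 0) L i = (\<Sum>u\<in>S. if u = w then L u i else 0)"
        unfolding lincomb_def by (intro sum.cong) auto
      then show ?thesis using 1 S w by (simp add: d_def lincomb_diff)
    qed
    then have "\<forall>u\<in>S. d u = 0" using b unfolding is_basis_family_iff by blast
    then have d: "(\<Sum>j<N. L w j * c j u) = (if u = w then 1 else 0)" if "u \<in> S" for u
      using that by (auto simp: d_def split: if_splits)
    have "(\<Sum>j<N. A i j * L w j) = T w i" for i
    proof -
      have "(\<Sum>j<N. A i j * L w j) = (\<Sum>u\<in>S. (\<Sum>j<N. L w j * c j u) * T u i)"
        unfolding A_def sum_distrib_right by (subst sum.swap) (simp add: mult_ac)
      also have "\<dots> = (\<Sum>u\<in>S. if u = w then T u i else 0)" using d by (intro sum.cong) auto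
      finally show ?thesis using S w by simp
    qed
    then show ?thesis using T[OF w] by (auto simp: mat_apply_def vec_def)
  qed
  then show ?thesis using that by blast
qed

lemma GL_mat_inverse:
  assumes "GL_mat N A"
  obtains B where "\<And>x. x \<in> vec N \<Longrightarrow> mat_apply N N B (mat_apply N N A x) = x"
proof -
  obtain B where "\<forall>i<N. \<forall>j<N. (\<Sum>k<N. B i k * A k j) = (if i = j then 1 else 0)"
    using assms unfolding GL_mat_def by (elim exE conjE)
  then show ?thesis using that[of B] by (simp add: mat_apply_mult mat_apply_identity)
qed

lemma mat_mult_eq_one_on_basis:
  assumes b: "is_basis_family N S L"
    and AB: "\<And>u. u \<in> S \<Longrightarrow> mat_apply N N A (mat_apply N N B (L u)) = L u"
  shows "\<forall>i<N. \<forall>j<N. (\<Sum>k<N. A i k * B k j) = (if i = j then 1 else 0)"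
proof (intro allI impI)
  fix i j assume ij: "i < N" "j < N"
  define e :: "nat \<Rightarrow> 'b" where "e = (\<lambda>k. if k = j then 1 else 0)"
  have "e \<in> vec N" using ij by (auto simp: e_def vec_def)
  then obtain c where c: "e = lincomb S c L" by (rule basis_expansion[OF b])
  have "mat_apply N N A (mat_apply N N B e) = lincomb S c (\<lambda>u. mat_apply N N A (mat_apply N N B (L u)))"
    unfolding c by (simp add: mat_apply_lincomb)
  also have "\<dots> = e" unfolding c by (intro lincomb_cong AB refl)
  finally have "mat_apply N N (\<lambda>i j. \<Sum>k<N. A i k * B k j) e i = e i"
    by (simp add: mat_apply_mult)
  then show "(\<Sum>k<N. A i k * B k j) = (if i = j then 1 else 0)"
    unfolding e_def mat_apply_unit[OF ij(2,1)] .
qed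

lemma mat_apply_zero: "mat_apply p q A (\<lambda>_. 0) = (\<lambda>_. 0)"
  by (simp add: mat_apply_def fun_eq_iff)

lemma mat_apply_add:
  "mat_apply p q A (\<lambda>i. x i + y i) = (\<lambda>i. mat_apply p q A x i + mat_apply p q A y i)"
  by (auto simp: mat_apply_def distrib_left sum.distrib)

text \<open>An invertible matrix does not change the kernel. Conversely, the matrices exchanging the
  two bases on the facet \<open>\<tau>\<close> are inverse to each other, and every other vertex has
  the same expansion over \<open>\<tau>\<close> in both families because expansions are
  relations.\<close>

lemma DJ_equiv_iff_relations:
  assumes V: "finite V" "\<And>\<sigma>. \<sigma> \<in> F \<Longrightarrow> \<sigma> \<subseteq> V" and F: "\<tau> \<in> F" "card \<tau> = N"
    and L1: "char_map F V N L1" and L2: "char_map F V N L2"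
  shows "DJ_equiv V N L1 L2 \<longleftrightarrow> relations V L1 = relations V L2"
proof
  assume "DJ_equiv V N L1 L2"
  then obtain A where GL: "GL_mat N A" and "\<forall>v\<in>V. L2 v = mat_apply N N A (L1 v)"
    unfolding DJ_equiv_def by (elim exE conjE)
  then have A: "L2 v = mat_apply N N A (L1 v)" if "v \<in> V" for v using that by simp
  obtain B where B: "\<And>x. x \<in> vec N \<Longrightarrow> mat_apply N N B (mat_apply N N A x) = x"
    using GL_mat_inverse[OF GL] by metis
  have vec: "lincomb V x L1 \<in> vec N" for x
    using L1 by (intro lincomb_in_vec) (auto simp: char_map_def)
  have "lincomb V x L2 = mat_apply N N A (lincomb V x L1)" for x
    unfolding mat_apply_lincomb using A by (intro lincomb_cong) auto
  then have "lincomb V x L2 = (\<lambda>_. 0) \<longleftrightarrow> lincomb V x L1 = (\<lambda>_. 0)" for x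
    using B[OF vec[of x]] mat_apply_zero[of N N A] mat_apply_zero[of N N B] by auto
  then show "relations V L1 = relations V L2" by (simp add: relations_def)
next
  assume eq: "relations V L1 = relations V L2"
  have fin: "finite \<tau>" and sub: "\<tau> \<subseteq> V" using V F finite_subset by blast+
  have b1: "is_basis_family N \<tau> L1" and b2: "is_basis_family N \<tau> L2"
    using L1 L2 F by (auto simp: char_map_def)
  have T1: "L1 u \<in> vec N" and T2: "L2 u \<in> vec N" if "u \<in> \<tau>" for u
    using b1 b2 that by (auto simp: is_basis_family_iff)
  obtain A where A: "\<And>u. u \<in> \<tau> \<Longrightarrow> mat_apply N N A (L1 u) = L2 u"
    using exists_mat_on_basis[OF fin b1, of L2 N] T2 by blast
  obtain B where B: "\<And>u. u \<in> \<tau> \<Longrightarrow> mat_apply N N B (L2 u) = L1 u"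
    using exists_mat_on_basis[OF fin b2, of L1 N] T1 by blast
  have "GL_mat N A"
    unfolding GL_mat_def
    using A B by (intro exI[of _ B] conjI mat_mult_eq_one_on_basis[OF b2]
        mat_mult_eq_one_on_basis[OF b1]) simp_all
  moreover have "L2 v = mat_apply N N A (L1 v)" if v: "v \<in> V" for v
  proof -
    have "L1 v \<in> vec N" using L1 v by (simp add: char_map_def)
    then obtain c where c: "L1 v = lincomb \<tau> c L1" by (rule basis_expansion[OF b1])
    then have "L2 v = lincomb \<tau> c L2"
      using eq by (simp add: expansion_iff_relation[OF V(1) sub v])
    also have "\<dots> = lincomb \<tau> c (\<lambda>u. mat_apply N N A (L1 u))"
      using A by (intro lincomb_cong) auto
    also have "\<dots> = mat_apply N N A (L1 v)" unfolding c by (simp add: mat_apply_lincomb)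
    finally show ?thesis .
  qed
  ultimately show "DJ_equiv V N L1 L2" by (auto simp: DJ_equiv_def)
qed

section \<open>Purity of star-shaped spheres\<close>

text \<open>
  The cones from \<open>c\<close> over lower-dimensional simplices are negligible, so the cones over the
  facets, which form a closed set, cover the whole space; the ray through a vertex meets the sphere
  only in that vertex, which therefore lies on a facet.
\<close>

lemma star_shaped_sphere_vertex_in_facet:
  assumes K: "simplicial_complex_on K m" and sph: "star_shaped_sphere K TYPE('n::finite)"
    and i: "i \<in> {1..m}"
  shows "\<exists>\<sigma>\<in>K. i \<in> \<sigma> \<and> card \<sigma> = CARD('n)"
proof -
  have "K \<subseteq> Pow {1..m}" using K by (auto simp: simplicial_complex_on_def)
  then have finK: "finite K" using finite_subset by blast
  have fin: "finite \<sigma>" if "\<sigma> \<in> K" for \<sigma>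
    using that \<open>K \<subseteq> Pow {1..m}\<close> finite_subset[of \<sigma> "{1..m}"] by auto
  have iK: "{i} \<in> K" using K i by (simp add: simplicial_complex_on_def)
  obtain x :: "nat \<Rightarrow> real^'n" and c where
    meet: "\<And>\<sigma> \<tau>. \<sigma> \<in> K \<Longrightarrow> \<tau> \<in> K \<Longrightarrow>
      convex hull (x ` \<sigma>) \<inter> convex hull (x ` \<tau>) = convex hull (x ` (\<sigma> \<inter> \<tau>))"
    and c: "c \<notin> (\<Union>\<sigma>\<in>K. convex hull (x ` \<sigma>))"
    and ray: "\<And>d. d \<noteq> 0 \<Longrightarrow> \<exists>!t::real. t > 0 \<and> c + t *\<^sub>R d \<in> (\<Union>\<sigma>\<in>K. convex hull (x ` \<sigma>))"
    and le: "\<And>\<sigma>. \<sigma> \<in> K \<Longrightarrow> card \<sigma> \<le> CARD('n)"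
    using sph unfolding star_shaped_sphere_def by metis
  define facets where "facets = {\<sigma>\<in>K. card \<sigma> = CARD('n)}"
  define G where "G = (\<Union>\<sigma>\<in>facets. convex hull (x ` \<sigma>))"
  \<comment> \<open>\<open>Z\<close> is the set of unit directions in which a facet is seen from
    \<open>c\<close>; it is compact, hence closed.\<close>
  define Z where "Z = (\<lambda>y. sgn (y - c)) ` G"
  have cG: "c \<notin> G" using c by (auto simp: G_def facets_def)
  have "compact G"
    unfolding G_def using finK fin
    by (intro compact_UN finite_imp_compact_convex_hull) (auto simp: facets_def)
  then have "compact Z"
    unfolding Z_def using cG
    by (intro compact_continuous_image continuous_on_sgn continuous_intros) auto
  define d0 where "d0 = x i - c"
  have xi: "x i \<in> (\<Union>\<sigma>\<in>K. convex hull (x ` \<sigma>))" using iK by (intro UN_I[of "{i}"]) auto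
  then have d0: "d0 \<noteq> 0" using c by (auto simp: d0_def)
  have "sgn d0 \<in> Z"
  proof (rule ccontr)
    assume nZ: "sgn d0 \<notin> Z"
    \<comment> \<open>\<open>U\<close> is the open cone of directions whose ray from
      \<open>c\<close> misses all facets. It contains \<open>d0\<close>, and it will be covered by
      finitely many proper linear subspaces, which is impossible for a nonempty open set.\<close>
    define U where "U = - {0} \<inter> sgn -` (- Z)"
    have "open U"
      unfolding U_def using \<open>compact Z\<close>
      by (intro continuous_open_preimage continuous_on_sgn continuous_intros)
        (auto simp: compact_imp_closed open_Compl)
    moreover have "d0 \<in> U" using d0 nZ by (simp add: U_def)
    moreover have "U \<subseteq> (\<Union>\<sigma>\<in>K - facets. span ((\<lambda>j. x j - c) ` \<sigma>))"
    proof
      fix d assume d: "d \<in> U"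
      then obtain t \<sigma> where t: "t > 0" "\<sigma> \<in> K" "c + t *\<^sub>R d \<in> convex hull (x ` \<sigma>)"
        using ray[of d] by (auto simp: U_def)
      have "\<sigma> \<notin> facets"
      proof
        assume "\<sigma> \<in> facets"
        then have "c + t *\<^sub>R d \<in> G" using t by (auto simp: G_def)
        then have "sgn (c + t *\<^sub>R d - c) \<in> Z" unfolding Z_def by (rule imageI)
        then show False using t(1) d by (simp add: sgn_scaleR U_def)
      qed
      have "(+) (- c) (c + t *\<^sub>R d) \<in> (+) (- c) ` (convex hull (x ` \<sigma>))"
        using t(3) by (rule imageI)
      also have "\<dots> = convex hull ((\<lambda>j. x j - c) ` \<sigma>)"
        unfolding convex_hull_translation[symmetric] by (simp add: image_image)
      finally have "t *\<^sub>R d \<in> span ((\<lambda>j. x j - c) ` \<sigma>)"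
        using convex_hull_subset_span by auto
      then have "(1 / t) *\<^sub>R (t *\<^sub>R d) \<in> span ((\<lambda>j. x j - c) ` \<sigma>)" by (rule span_mul)
      then show "d \<in> (\<Union>\<sigma>\<in>K - facets. span ((\<lambda>j. x j - c) ` \<sigma>))"
        using t \<open>\<sigma> \<notin> facets\<close> by auto
    qed
    moreover have "negligible (\<Union>\<sigma>\<in>K - facets. span ((\<lambda>j. x j - c) ` \<sigma>))"
    proof (intro negligible_Union finite_imageI)
      show "finite (K - facets)" using finK by simp
      fix T assume "T \<in> (\<lambda>\<sigma>. span ((\<lambda>j. x j - c) ` \<sigma>)) ` (K - facets)"
      then obtain \<sigma> where \<sigma>: "\<sigma> \<in> K" "\<sigma> \<notin> facets" "T = span ((\<lambda>j. x j - c) ` \<sigma>)" by blast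
      have "dim T \<le> card ((\<lambda>j. x j - c) ` \<sigma>)"
        using \<sigma> fin by (simp add: dim_le_card')
      also have "\<dots> \<le> card \<sigma>" using \<sigma> fin by (intro card_image_le)
      also have "\<dots> < DIM(real^'n)" using \<sigma> le[of \<sigma>] by (auto simp: facets_def)
      finally show "negligible T" by (intro negligible_lowdim) 
    qed
    ultimately show False using open_not_negligible negligible_subset by blast
  qed
  then obtain y \<sigma> where y: "sgn d0 = sgn (y - c)" "\<sigma> \<in> facets" "y \<in> convex hull (x ` \<sigma>)"
    by (auto simp: Z_def G_def)
  have yc: "y \<noteq> c" using y cG by (auto simp: G_def)
  \<comment> \<open>This scale puts \<open>y\<close> on the ray through the vertex. Both
    \<open>y\<close> and \<open>x i\<close> lie on the sphere there, so uniqueness on the ray forces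
    \<open>t = 1\<close>.\<close>
  define t where "t = norm (y - c) / norm d0"
  have "t > 0" using yc d0 by (simp add: t_def)
  have "t *\<^sub>R d0 = norm (y - c) *\<^sub>R sgn d0" by (simp add: t_def sgn_div_norm divide_inverse)
  also have "\<dots> = y - c" using y(1) yc by (simp add: sgn_div_norm)
  finally have "c + t *\<^sub>R d0 \<in> (\<Union>\<sigma>\<in>K. convex hull (x ` \<sigma>))"
    using y by (auto simp: facets_def)
  moreover have "c + 1 *\<^sub>R d0 \<in> (\<Union>\<sigma>\<in>K. convex hull (x ` \<sigma>))"
    using xi by (simp add: d0_def)
  ultimately have "t = 1" using ray[OF d0] \<open>t > 0\<close> zero_less_one by blast
  then have "y = x i" using \<open>t *\<^sub>R d0 = _\<close> \<open>_ = y - c\<close> by (simp add: d0_def)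
  \<comment> \<open>If \<open>i\<close> were not in \<open>\<sigma>\<close>, this hull would be
    empty.\<close>
  then have "x i \<in> convex hull (x ` ({i} \<inter> \<sigma>))"
    using meet[OF iK, of \<sigma>] y by (auto simp: facets_def)
  then have "i \<in> \<sigma>" by (cases "i \<in> \<sigma>") auto
  then show ?thesis using y(2) by (auto simp: facets_def)
qed

section \<open>Relation modules over \<open>K(J)\<close>\<close>

lemma finite_VJ: "finite (VJ m J)"
proof -
  have "VJ m J = Sigma {1..m} (\<lambda>i. {1..J i})" by (auto simp: VJ_def)
  then show ?thesis by simp
qed

lemma card_VJ:
  assumes "\<forall>i\<in>{1..m}. 0 < J i"
  shows "card (VJ m J) = m + (\<Sum>i\<in>{1..m}. J i - 1)"
proof -
  have "VJ m J = Sigma {1..m} (\<lambda>i. {1..J i})" by (auto simp: VJ_def)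
  then have "card (VJ m J) = (\<Sum>i\<in>{1..m}. J i)" by simp
  also have "\<dots> = (\<Sum>i\<in>{1..m}. 1 + (J i - 1))" using assms by (intro sum.cong) auto
  finally show ?thesis by (simp only: sum.distrib) simp
qed

definition section_set :: "(nat \<Rightarrow> nat) \<Rightarrow> nat set \<Rightarrow> (nat \<times> nat) set" where
  "section_set \<alpha> T = (\<lambda>i. (i, \<alpha> i)) ` T"

definition facet_J :: "nat \<Rightarrow> (nat \<Rightarrow> nat) \<Rightarrow> nat set \<Rightarrow> (nat \<Rightarrow> nat) \<Rightarrow> (nat \<times> nat) set" where
  "facet_J m J \<tau> \<alpha> = VJ m J - section_set \<alpha> ({1..m} - \<tau>)"

definition pull :: "nat \<Rightarrow> (nat \<Rightarrow> nat) \<Rightarrow> (nat \<times> nat \<Rightarrow> 'r::zero) \<Rightarrow> nat \<Rightarrow> 'r" where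
  "pull m \<alpha> x = (\<lambda>i. if i \<in> {1..m} then x (i, \<alpha> i) else 0)"

lemma card_section_set: "card (section_set \<alpha> T) = card T"
  unfolding section_set_def by (intro card_image) (auto simp: inj_on_def)

lemma section_set_subset:
  assumes "\<alpha> \<in> IJ m J" "T \<subseteq> {1..m}"
  shows "section_set \<alpha> T \<subseteq> VJ m J"
  using assms by (auto simp: section_set_def VJ_def IJ_def)

lemma sum_section_set: "(\<Sum>u\<in>section_set \<alpha> T. f u) = (\<Sum>i\<in>T. f (i, \<alpha> i))"
  unfolding section_set_def by (subst sum.reindex) (auto simp: inj_on_def)

lemma lincomb_section_set:
  "lincomb (section_set \<alpha> T) c L = lincomb T (\<lambda>i. c (i, \<alpha> i)) (\<lambda>i. L (i, \<alpha> i))"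
  by (simp add: lincomb_def sum_section_set)

lemma sigma_alpha_eq: "sigma_alpha m J \<alpha> = VJ m J - section_set \<alpha> {1..m}"
  by (auto simp: sigma_alpha_def section_set_def)

lemma IJ_update:
  assumes "\<alpha> \<in> IJ m J" "i \<in> {1..m}" "1 \<le> k" "k \<le> J i"
  shows "\<alpha>(i := k) \<in> IJ m J"
  using assms by (auto simp: IJ_def)

lemma IJ_nonempty:
  assumes "\<forall>i\<in>{1..m}. 0 < J i"
  shows "(\<lambda>i. if i \<in> {1..m} then 1 else 0) \<in> IJ m J"
  using assms by (auto simp: IJ_def Suc_le_eq)

lemma submodule_pull: "submodule P \<Longrightarrow> submodule (pull m \<alpha> ` P)"
proof -
  assume P: "submodule P"
  have 0: "(\<lambda>_. 0) = pull m \<alpha> (\<lambda>_. 0)"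
    and 1: "(\<lambda>v. pull m \<alpha> x v + pull m \<alpha> y v) = pull m \<alpha> (\<lambda>v. x v + y v)"
    and 2: "(\<lambda>v. a * pull m \<alpha> x v) = pull m \<alpha> (\<lambda>v. a * x v)" for x y :: "nat \<times> nat \<Rightarrow> 'a" and a
    by (auto simp: pull_def)
  have "(\<lambda>_. 0) \<in> P" using P by (simp add: submodule_def)
  then have "(\<lambda>_. 0) \<in> pull m \<alpha> ` P" by (subst 0) (rule imageI)
  moreover have "(\<lambda>v. x v + y v) \<in> pull m \<alpha> ` P" if "x \<in> pull m \<alpha> ` P" "y \<in> pull m \<alpha> ` P" for x y
    using that submodule_add[OF P] by (auto simp: 1)
  moreover have "(\<lambda>v. a * x v) \<in> pull m \<alpha> ` P" if "x \<in> pull m \<alpha> ` P" for a x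
    using that submodule_scale[OF P] by (auto simp: 2)
  ultimately show ?thesis unfolding submodule_def by simp
qed

lemma pull_supported: "pull m \<alpha> ` P \<subseteq> supported_on {1..m}"
  by (auto simp: pull_def supported_on_def)

text \<open>The complement of the facet is a partial section, so its coordinates may be indexed by
  the first component alone.\<close>

lemma chart_facet_J:
  assumes "\<alpha> \<in> IJ m J"
  shows "chart (VJ m J) (facet_J m J \<tau> \<alpha>) P \<longleftrightarrow>
    (\<forall>y. \<exists>x\<in>P. \<forall>i\<in>{1..m} - \<tau>. x (i, \<alpha> i) = y i)
    \<and> (\<forall>x\<in>P. (\<forall>i\<in>{1..m} - \<tau>. x (i, \<alpha> i) = 0) \<longrightarrow> x = (\<lambda>_. 0))"
proof -
  have eq: "VJ m J - facet_J m J \<tau> \<alpha> = section_set \<alpha> ({1..m} - \<tau>)"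
    using section_set_subset[OF assms, of "{1..m} - \<tau>"] by (auto simp: facet_J_def)
  have "(\<forall>y. \<exists>x\<in>P. \<forall>i\<in>{1..m} - \<tau>. x (i, \<alpha> i) = y (i, \<alpha> i)) \<longleftrightarrow>
    (\<forall>y. \<exists>x\<in>P. \<forall>i\<in>{1..m} - \<tau>. x (i, \<alpha> i) = y i)" (is "?a \<longleftrightarrow> ?b")
  proof
    assume a: ?a
    show ?b
    proof
      fix y :: "nat \<Rightarrow> 'a"
      show "\<exists>x\<in>P. \<forall>i\<in>{1..m} - \<tau>. x (i, \<alpha> i) = y i" using spec[OF a, of "\<lambda>u. y (fst u)"] by simp
    qed
  next
    assume b: ?b
    show ?a
    proof
      fix y :: "nat \<times> nat \<Rightarrow> 'a"
      show "\<exists>x\<in>P. \<forall>i\<in>{1..m} - \<tau>. x (i, \<alpha> i) = y (i, \<alpha> i)"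
        using spec[OF b, of "\<lambda>i. y (i, \<alpha> i)"] by simp
    qed
  qed
  then show ?thesis unfolding chart_def eq by (simp add: section_set_def)
qed

section \<open>Changing the multiplicities\<close>

text \<open>Pullback along the vertex map \<open>(i, k)\<close> to \<open>(i, s i k)\<close> from
  K(J') to K(J). It serves both subpuzzles, where \<open>s i\<close> enumerates the selected
  indices, and edges, where \<open>s i\<close> picks the two endpoints and need not be
  injective.\<close>

definition reindex :: "nat \<Rightarrow> (nat \<Rightarrow> nat) \<Rightarrow> (nat \<Rightarrow> nat \<Rightarrow> nat) \<Rightarrow> (nat \<times> nat \<Rightarrow> 'r::zero) \<Rightarrow> nat \<times> nat \<Rightarrow> 'r" where
  "reindex m J' s x = (\<lambda>(i, k). if (i, k) \<in> VJ m J' then x (i, s i k) else 0)"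

lemma pull_reindex:
  assumes "\<alpha> \<in> IJ m J'"
  shows "pull m \<alpha> (reindex m J' s x) = pull m (\<lambda>i. if i \<in> {1..m} then s i (\<alpha> i) else 0) x"
  using assms by (auto simp: pull_def reindex_def VJ_def IJ_def)

lemma submodule_reindex:
  assumes P: "submodule P"
  shows "submodule (reindex m J' s ` P)"
proof -
  have 0: "(\<lambda>_. 0) = reindex m J' s (\<lambda>_. 0)"
    and 1: "(\<lambda>v. reindex m J' s x v + reindex m J' s y v) = reindex m J' s (\<lambda>v. x v + y v)"
    and 2: "(\<lambda>v. a * reindex m J' s x v) = reindex m J' s (\<lambda>v. a * x v)"
    for x y :: "nat \<times> nat \<Rightarrow> 'a" and a
    by (auto simp: reindex_def)
  have "(\<lambda>_. 0) \<in> P" using P by (simp add: submodule_def)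
  then have "(\<lambda>_. 0) \<in> reindex m J' s ` P" by (subst 0) (rule imageI)
  moreover have "(\<lambda>v. x v + y v) \<in> reindex m J' s ` P"
    if "x \<in> reindex m J' s ` P" "y \<in> reindex m J' s ` P" for x y
    using that submodule_add[OF P] by (auto simp: 1)
  moreover have "(\<lambda>v. a * x v) \<in> reindex m J' s ` P" if "x \<in> reindex m J' s ` P" for a x
    using that submodule_scale[OF P] by (auto simp: 2)
  ultimately show ?thesis unfolding submodule_def by simp
qed

lemma sorted_list_index:
  assumes "finite S" "a \<in> S"
  shows "\<exists>k. 1 \<le> k \<and> k \<le> card S \<and> sorted_list_of_set S ! (k - 1) = a"
proof -
  have "a \<in> set (sorted_list_of_set S)" using assms by simp
  then obtain j where "j < length (sorted_list_of_set S)" "sorted_list_of_set S ! j = a"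
    by (metis in_set_conv_nth)
  then show ?thesis by (intro exI[of _ "Suc j"]) simp
qed

text \<open>These are the only properties of the sphere that the combinatorial argument draws on.
  \<open>facet_exists\<close> is listed separately because \<open>vertex_in_facet\<close> is vacuous
  for \<open>m = 0\<close>.\<close>

locale pure_complex =
  fixes K :: "nat set set" and m n :: nat
  assumes complex: "simplicial_complex_on K m"
    and card_le: "\<sigma> \<in> K \<Longrightarrow> card \<sigma> \<le> n"
    and vertex_in_facet: "i \<in> {1..m} \<Longrightarrow> \<exists>\<sigma>\<in>K. i \<in> \<sigma> \<and> card \<sigma> = n"
    and facet_exists: "\<exists>\<sigma>\<in>K. card \<sigma> = n"
begin

abbreviation char_relK :: "(nat \<Rightarrow> 'r::comm_ring_1) set \<Rightarrow> bool" where
  "char_relK \<equiv> char_relations K {1..m} n"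

abbreviation char_relJ :: "(nat \<Rightarrow> nat) \<Rightarrow> (nat \<times> nat \<Rightarrow> 'r::comm_ring_1) set \<Rightarrow> bool" where
  "char_relJ J \<equiv> char_relations (KJ K m J) (VJ m J) (dimJ m n J)"

abbreviation char_mapJ :: "(nat \<Rightarrow> nat) \<Rightarrow> (nat \<times> nat \<Rightarrow> nat \<Rightarrow> 'r::comm_ring_1) \<Rightarrow> bool" where
  "char_mapJ J \<equiv> char_map (KJ K m J) (VJ m J) (dimJ m n J)"

lemma face_subset: "\<sigma> \<in> K \<Longrightarrow> \<sigma> \<subseteq> {1..m}"
  using complex by (simp add: simplicial_complex_on_def)

lemma face_down: "\<sigma> \<in> K \<Longrightarrow> \<tau> \<subseteq> \<sigma> \<Longrightarrow> \<tau> \<in> K"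
  using complex by (simp add: simplicial_complex_on_def)

section \<open>Facets of K(J), and modules over K(J) tested on their pullbacks\<close>

lemma nonface_contains_min_nonface:
  assumes "\<tau> \<subseteq> {1..m}" "\<tau> \<notin> K"
  shows "\<exists>\<rho>\<in>min_nonfaces K m. \<rho> \<subseteq> \<tau>"
proof -
  have "finite \<tau>" using assms(1) finite_subset by blast
  then show ?thesis using assms
  proof (induction \<tau> rule: finite_psubset_induct)
    case (psubset \<tau>)
    show ?case
    proof (cases "\<forall>i\<in>\<tau>. \<tau> - {i} \<in> K")
      case True
      then show ?thesis using psubset.prems by (auto simp: min_nonfaces_def)
    next
      case False
      then obtain i where "i \<in> \<tau>" "\<tau> - {i} \<notin> K" by blast
      then show ?thesis using psubset.IH[of "\<tau> - {i}"] psubset.prems by blast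
    qed
  qed
qed

text \<open>The blowup of \<open>\<tau>\<close> lies in \<open>\<sigma>\<close> exactly when
  \<open>\<tau>\<close> consists of vertices whose whole fibre lies in \<open>\<sigma>\<close>, and
  a vertex set is a face of \<open>K\<close> exactly when it contains no minimal non-face.\<close>

lemma KJ_iff:
  "\<sigma> \<in> KJ K m J \<longleftrightarrow> \<sigma> \<subseteq> VJ m J \<and> {i \<in> {1..m}. blowup J {i} \<subseteq> \<sigma>} \<in> K"
    (is "_ \<longleftrightarrow> _ \<and> ?f \<in> K")
proof -
  have b: "blowup J \<tau> \<subseteq> \<sigma> \<longleftrightarrow> \<tau> \<subseteq> ?f" if "\<tau> \<subseteq> {1..m}" for \<tau>
    using that by (fastforce simp: blowup_def)
  have "?f \<in> K \<longleftrightarrow> (\<forall>\<tau>\<in>min_nonfaces K m. \<not> \<tau> \<subseteq> ?f)"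
  proof
    assume "?f \<in> K"
    then show "\<forall>\<tau>\<in>min_nonfaces K m. \<not> \<tau> \<subseteq> ?f"
      using face_down by (auto simp: min_nonfaces_def)
  next
    assume "\<forall>\<tau>\<in>min_nonfaces K m. \<not> \<tau> \<subseteq> ?f"
    then show "?f \<in> K" using nonface_contains_min_nonface[of ?f] by blast
  qed
  also have "\<dots> \<longleftrightarrow> (\<forall>\<tau>\<in>min_nonfaces K m. \<not> blowup J \<tau> \<subseteq> \<sigma>)"
    using b by (auto simp: min_nonfaces_def)
  finally show ?thesis by (auto simp: KJ_def)
qed

lemma facet_J_in_KJ:
  assumes J: "\<forall>i\<in>{1..m}. 0 < J i" and \<tau>: "\<tau> \<in> K" "card \<tau> = n" and \<alpha>: "\<alpha> \<in> IJ m J"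
  shows "facet_J m J \<tau> \<alpha> \<in> KJ K m J" "card (facet_J m J \<tau> \<alpha>) = dimJ m n J"
proof -
  have \<tau>m: "\<tau> \<subseteq> {1..m}" using \<tau> face_subset by blast
  have "{i \<in> {1..m}. blowup J {i} \<subseteq> facet_J m J \<tau> \<alpha>} = \<tau>"
  proof (intro set_eqI iffI)
    fix i assume i: "i \<in> {i \<in> {1..m}. blowup J {i} \<subseteq> facet_J m J \<tau> \<alpha>}"
    then have "(i, \<alpha> i) \<in> blowup J {i}" using \<alpha> by (auto simp: blowup_def IJ_def)
    then have "(i, \<alpha> i) \<in> facet_J m J \<tau> \<alpha>" using i by blast
    then show "i \<in> \<tau>" using i by (auto simp: facet_J_def section_set_def)
  next
    fix i assume "i \<in> \<tau>"
    then show "i \<in> {i \<in> {1..m}. blowup J {i} \<subseteq> facet_J m J \<tau> \<alpha>}"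
      using \<tau>m by (auto simp: blowup_def facet_J_def VJ_def section_set_def)
  qed
  then show "facet_J m J \<tau> \<alpha> \<in> KJ K m J"
    using \<tau> by (auto simp: KJ_iff facet_J_def)
  have "card (facet_J m J \<tau> \<alpha>) = card (VJ m J) - card ({1..m} - \<tau>)"
    unfolding facet_J_def card_section_set[symmetric, of "{1..m} - \<tau>" \<alpha>]
    using section_set_subset[OF \<alpha>, of "{1..m} - \<tau>"] finite_VJ finite_subset
    by (intro card_Diff_subset) blast+
  also have "card ({1..m} - \<tau>) = m - n"
    using \<tau>m \<tau> finite_subset[OF \<tau>m] by (simp add: card_Diff_subset)
  finally show "card (facet_J m J \<tau> \<alpha>) = dimJ m n J"
    using card_VJ[OF J] card_mono[OF _ \<tau>m] \<tau> by (simp add: dimJ_def)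
qed

text \<open>Each fibre not contained in \<open>\<sigma>\<close> misses some point, and choosing one
  per fibre gives a partial section in the complement of \<open>\<sigma>\<close>. The complement has
  \<open>m - n\<close> points and the section at least that many, so they coincide.\<close>

lemma KJ_facetE:
  assumes J: "\<forall>i\<in>{1..m}. 0 < J i" and \<sigma>: "\<sigma> \<in> KJ K m J" "card \<sigma> = dimJ m n J"
  obtains \<tau> \<alpha> where "\<tau> \<in> K" "card \<tau> = n" "\<alpha> \<in> IJ m J" "\<sigma> = facet_J m J \<tau> \<alpha>"
proof -
  define \<tau> where "\<tau> = {i \<in> {1..m}. blowup J {i} \<subseteq> \<sigma>}"
  have \<tau>: "\<tau> \<in> K" and sub: "\<sigma> \<subseteq> VJ m J" using \<sigma> by (auto simp: KJ_iff \<tau>_def)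
  have \<tau>m: "\<tau> \<subseteq> {1..m}" by (auto simp: \<tau>_def)
  have "\<forall>i. \<exists>k. i \<in> {1..m} - \<tau> \<longrightarrow> 1 \<le> k \<and> k \<le> J i \<and> (i, k) \<notin> \<sigma>"
    by (auto simp: \<tau>_def blowup_def)
  then obtain k where k: "\<And>i. i \<in> {1..m} - \<tau> \<Longrightarrow> 1 \<le> k i \<and> k i \<le> J i \<and> (i, k i) \<notin> \<sigma>"
    by metis
  \<comment> \<open>On \<open>\<tau>\<close> the value 1 is an arbitrary admissible choice, since
    the facet reads \<open>\<alpha>\<close> only off \<open>\<tau>\<close>.\<close>
  define \<alpha> where "\<alpha> = (\<lambda>i. if i \<in> {1..m} - \<tau> then k i else if i \<in> {1..m} then 1 else 0)"
  have \<alpha>: "\<alpha> \<in> IJ m J" using k J by (auto simp: \<alpha>_def IJ_def Suc_le_eq)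
  let ?T = "section_set \<alpha> ({1..m} - \<tau>)"
  have T: "?T \<subseteq> VJ m J - \<sigma>"
    using section_set_subset[OF \<alpha>, of "{1..m} - \<tau>"] k by (auto simp: section_set_def \<alpha>_def)
  have fin: "finite (VJ m J - \<sigma>)" using finite_VJ by blast
  have cT: "card ?T = m - card \<tau>"
    using \<tau>m finite_subset[OF \<tau>m] by (simp add: card_section_set card_Diff_subset)
  have "card (VJ m J - \<sigma>) = card (VJ m J) - card \<sigma>"
    using sub finite_VJ finite_subset by (intro card_Diff_subset) blast+
  then have cV: "card (VJ m J - \<sigma>) = m - n"
    using card_VJ[OF J] \<sigma>(2) by (simp add: dimJ_def)
  have \<tau>n: "card \<tau> \<le> n" using card_le \<tau> by blast
  have \<tau>m': "card \<tau> \<le> m" using card_mono[OF _ \<tau>m] by simp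
  \<comment> \<open>With truncated subtraction, \<open>m - card \<tau> \<le> m - n\<close> bounds
    \<open>card \<tau>\<close> from below by \<open>n\<close> only once \<open>n \<le> m\<close> is
    known.\<close>
  obtain \<rho> where "\<rho> \<in> K" "card \<rho> = n" using facet_exists by blast
  then have nm: "n \<le> m" using card_mono[of "{1..m}" \<rho>] face_subset by force
  have "m - card \<tau> \<le> m - n" using card_mono[OF fin T] cT cV by simp
  then have "card \<tau> = n" using \<tau>n \<tau>m' nm by linarith
  moreover have "?T = VJ m J - \<sigma>"
    using card_seteq[OF fin T] cT cV \<open>card \<tau> = n\<close> by simp
  then have "\<sigma> = facet_J m J \<tau> \<alpha>" using sub by (auto simp: facet_J_def)
  ultimately show ?thesis using that \<tau> \<alpha> by blast
qed

lemma char_relJ_iff: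
  assumes J: "\<forall>i\<in>{1..m}. 0 < J i"
  shows "char_relJ J P \<longleftrightarrow> submodule P \<and> P \<subseteq> supported_on (VJ m J)
    \<and> (\<forall>\<alpha>\<in>IJ m J. \<forall>\<tau>\<in>K. card \<tau> = n \<longrightarrow> chart (VJ m J) (facet_J m J \<tau> \<alpha>) P)"
  unfolding char_relations_def
  using facet_J_in_KJ[OF J] KJ_facetE[OF J] by metis

text \<open>The chart of \<open>P\<close> at \<open>facet_J m J \<tau> \<alpha>\<close> uses the
  coordinates \<open>(i, \<alpha> i)\<close> with \<open>i\<close> off \<open>\<tau>\<close>; these
  are the coordinates off \<open>\<tau>\<close> of the pullback.\<close>

lemma char_relK_pull:
  assumes J: "\<forall>i\<in>{1..m}. 0 < J i" and P: "char_relJ J P" and \<alpha>: "\<alpha> \<in> IJ m J"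
  shows "char_relK (pull m \<alpha> ` P)"
  unfolding char_relations_def
proof (intro conjI ballI impI pull_supported submodule_pull)
  show "submodule P" using P by (simp add: char_relations_def)
  fix \<tau> assume \<tau>: "\<tau> \<in> K" "card \<tau> = n"
  then have c: "chart (VJ m J) (facet_J m J \<tau> \<alpha>) P" using P \<alpha> char_relJ_iff[OF J] by blast
  show "chart {1..m} \<tau> (pull m \<alpha> ` P)"
    unfolding chart_def
  proof (intro conjI allI ballI impI)
    fix y
    obtain x where "x \<in> P" "\<forall>i\<in>{1..m} - \<tau>. x (i, \<alpha> i) = y i"
      using c unfolding chart_facet_J[OF \<alpha>] by (elim conjE allE[of _ y] bexE)
    then show "\<exists>x\<in>pull m \<alpha> ` P. \<forall>i\<in>{1..m} - \<tau>. x i = y i"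
      by (intro bexI[of _ "pull m \<alpha> x"]) (auto simp: pull_def)
  next
    fix z assume "z \<in> pull m \<alpha> ` P" and 0: "\<forall>i\<in>{1..m} - \<tau>. z i = 0"
    then obtain x where x: "x \<in> P" "z = pull m \<alpha> x" by blast
    then have "x (i, \<alpha> i) = 0" if "i \<in> {1..m} - \<tau>" for i
      using 0 that by (auto simp: pull_def)
    then have "x = (\<lambda>_. 0)" using c x(1) unfolding chart_facet_J[OF \<alpha>] by simp
    then show "z = (\<lambda>_. 0)" using x(2) by (simp add: pull_def)
  qed
qed

text \<open>The difference vanishes off a facet through \<open>v\<close>, so its chart kills it.
  This rigidity is the only use of \<open>vertex_in_facet\<close>; it makes lifts along edges
  unique.\<close>

lemma char_relK_determined:
  assumes "char_relK A" "x \<in> A" "y \<in> A" "v \<in> {1..m}" "\<And>i. i \<noteq> v \<Longrightarrow> x i = y i"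
  shows "x = y"
proof -
  obtain \<sigma> where \<sigma>: "\<sigma> \<in> K" "v \<in> \<sigma>" "card \<sigma> = n" using vertex_in_facet assms(4) by blast
  have sub: "submodule A" and c: "chart {1..m} \<sigma> A"
    using assms(1) \<sigma> by (auto simp: char_relations_def)
  have "(\<lambda>i. x i - y i) = (\<lambda>_. 0)"
    using \<sigma>(2) assms(5) by (intro chart_unique[OF c submodule_diff[OF sub assms(2,3)]]) force
  then show ?thesis by (simp add: fun_eq_iff)
qed

text \<open>Converse to \<open>char_relK_pull\<close>. Extension in a chart is inherited from the
  pullback; for uniqueness, \<open>pull\<close> must be injective on \<open>P\<close>. If one
  pullback of \<open>x\<close> is zero, changing a single index yields a pullback that vanishes off
  one vertex, hence is zero too, so \<open>x\<close> vanishes at every vertex of K(J).\<close>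

lemma char_relJ_of_pull:
  assumes J: "\<forall>i\<in>{1..m}. 0 < J i" and P: "submodule P" "P \<subseteq> supported_on (VJ m J)"
    and char: "\<And>\<alpha>. \<alpha> \<in> IJ m J \<Longrightarrow> char_relK (pull m \<alpha> ` P)"
  shows "char_relJ J P"
proof -
  have inj: "x = (\<lambda>_. 0)" if x: "x \<in> P" and \<alpha>: "\<alpha> \<in> IJ m J" and 0: "pull m \<alpha> x = (\<lambda>_. 0)" for x \<alpha>
  proof
    fix u
    show "x u = 0"
    proof (cases "u \<in> VJ m J")
      case False
      then show ?thesis using x P(2) by (cases u) (auto simp: supported_on_def)
    next
      case True
      then obtain i k where u: "u = (i, k)" "i \<in> {1..m}" "1 \<le> k" "k \<le> J i" by (auto simp: VJ_def)
      define \<beta> where "\<beta> = \<alpha>(i := k)"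
      have \<beta>: "\<beta> \<in> IJ m J" unfolding \<beta>_def using IJ_update \<alpha> u by blast
      have "(\<lambda>_. 0) \<in> pull m \<beta> ` P"
        using char[OF \<beta>] by (simp add: char_relations_def submodule_def)
      moreover have "pull m \<beta> x j = 0" if "j \<noteq> i" for j
        using that fun_cong[OF 0, of j] by (auto simp: pull_def \<beta>_def split: if_splits)
      ultimately have "pull m \<beta> x = (\<lambda>_. 0)"
        using x by (intro char_relK_determined[OF char[OF \<beta>] _ _ u(2)]) auto
      then have "pull m \<beta> x i = 0" by simp
      then show ?thesis using u by (simp add: pull_def \<beta>_def)
    qed
  qed
  have "chart (VJ m J) (facet_J m J \<tau> \<alpha>) P" if \<alpha>: "\<alpha> \<in> IJ m J" and \<tau>: "\<tau> \<in> K" "card \<tau> = n" for \<alpha> \<tau>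
    unfolding chart_facet_J[OF \<alpha>]
  proof (intro conjI allI ballI impI)
    have c: "chart {1..m} \<tau> (pull m \<alpha> ` P)"
      using char[OF \<alpha>] \<tau> by (simp add: char_relations_def)
    {
      fix y
      obtain z where z: "z \<in> pull m \<alpha> ` P" "\<And>i. i \<in> {1..m} - \<tau> \<Longrightarrow> z i = y i"
        using chart_extend[OF c, of y] by metis
      obtain x where "x \<in> P" "z = pull m \<alpha> x" using z(1) by blast
      then show "\<exists>x\<in>P. \<forall>i\<in>{1..m} - \<tau>. x (i, \<alpha> i) = y i"
        using z(2) by (intro bexI[of _ x]) (auto simp: pull_def)
    next
      fix x assume x: "x \<in> P" "\<forall>i\<in>{1..m} - \<tau>. x (i, \<alpha> i) = 0"
      have "pull m \<alpha> x = (\<lambda>_. 0)"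
        using x by (intro chart_unique[OF c]) (auto simp: pull_def)
      then show "x = (\<lambda>_. 0)" using inj x(1) \<alpha> by blast
    }
  qed
  then show ?thesis using P by (simp add: char_relJ_iff[OF J])
qed

section \<open>Projections as pullbacks of relations\<close>

lemma facet_J_eq:
  assumes "\<alpha> \<in> IJ m J" "\<tau> \<subseteq> {1..m}"
  shows "facet_J m J \<tau> \<alpha> = sigma_alpha m J \<alpha> \<union> section_set \<alpha> \<tau>"
    and "sigma_alpha m J \<alpha> \<inter> section_set \<alpha> \<tau> = {}"
  using section_set_subset[OF assms] assms(2)
  by (auto simp: facet_J_def sigma_alpha_eq section_set_def)

lemma lincomb_facet_J:
  assumes "\<alpha> \<in> IJ m J" "\<tau> \<subseteq> {1..m}"
  shows "lincomb (facet_J m J \<tau> \<alpha>) c L = (\<lambda>i. lincomb (sigma_alpha m J \<alpha>) c L i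
    + lincomb \<tau> (\<lambda>i. c (i, \<alpha> i)) (\<lambda>i. L (i, \<alpha> i)) i)"
proof
  fix i
  have "finite (sigma_alpha m J \<alpha>)" "finite (section_set \<alpha> \<tau>)"
    using finite_VJ finite_subset[OF assms(2)] by (auto simp: sigma_alpha_def section_set_def)
  then have "lincomb (facet_J m J \<tau> \<alpha>) c L i
      = lincomb (sigma_alpha m J \<alpha>) c L i + lincomb (section_set \<alpha> \<tau>) c L i"
    unfolding facet_J_eq(1)[OF assms] lincomb_def
    using facet_J_eq(2)[OF assms] by (simp add: sum.union_disjoint)
  then show "lincomb (facet_J m J \<tau> \<alpha>) c L i = lincomb (sigma_alpha m J \<alpha>) c L i
    + lincomb \<tau> (\<lambda>i. c (i, \<alpha> i)) (\<lambda>i. L (i, \<alpha> i)) i"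
    by (simp add: lincomb_section_set)
qed

lemma lincomb_VJ:
  assumes "\<alpha> \<in> IJ m J"
  shows "lincomb (VJ m J) x L = (\<lambda>i. lincomb (sigma_alpha m J \<alpha>) x L i
    + lincomb {1..m} (pull m \<alpha> x) (\<lambda>i. L (i, \<alpha> i)) i)"
proof -
  have "VJ m J = facet_J m J {1..m} \<alpha>" by (simp add: facet_J_def section_set_def)
  moreover have "lincomb {1..m} (pull m \<alpha> x) (\<lambda>i. L (i, \<alpha> i))
      = lincomb {1..m} (\<lambda>i. x (i, \<alpha> i)) (\<lambda>i. L (i, \<alpha> i))"
    by (intro lincomb_cong) (auto simp: pull_def)
  ultimately show ?thesis using lincomb_facet_J[OF assms, of "{1..m}"] by simp
qed

text \<open>Encodes a D-J class by its relation module, so that \<open>DJ_class\<close> and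
  \<open>proj_class\<close> become values of one function, injective on characteristic
  modules.\<close>

definition class_of :: "(nat \<Rightarrow> 'r::comm_ring_1) set \<Rightarrow> (nat \<Rightarrow> nat \<Rightarrow> 'r) set" where
  "class_of A = {l. char_map K {1..m} n l \<and> relations {1..m} l = A}"

text \<open>\<open>M\<close> kills the vectors on \<open>\<sigma>(\<alpha>)\<close>, so applying it
  to a relation over K(J) leaves a relation of \<open>l\<close>. Conversely, a relation of
  \<open>l\<close> gives a combination in the kernel of \<open>M\<close>; writing that in the
  vectors on \<open>\<sigma>(\<alpha>)\<close> and negating the coefficients completes it to a
  relation over K(J).\<close>

lemma relations_of_proj:
  assumes L: "char_mapJ J L" and \<alpha>: "\<alpha> \<in> IJ m J"
    and ker: "{x\<in>vec (dimJ m n J). mat_apply n (dimJ m n J) M x = (\<lambda>_. 0)}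
                = {lincomb (sigma_alpha m J \<alpha>) c L | c. True}"
    and l: "\<And>i. i \<in> {1..m} \<Longrightarrow> l i = mat_apply n (dimJ m n J) M (L (i, \<alpha> i))"
  shows "relations {1..m} l = pull m \<alpha> ` relations (VJ m J) L"
proof (intro set_eqI iffI)
  let ?N = "dimJ m n J" and ?\<sigma> = "sigma_alpha m J \<alpha>"
  have Mlin: "mat_apply n ?N M (lincomb {1..m} z (\<lambda>i. L (i, \<alpha> i))) = lincomb {1..m} z l" for z
    unfolding mat_apply_lincomb using l by (intro lincomb_cong) auto
  {
    fix z assume "z \<in> pull m \<alpha> ` relations (VJ m J) L"
    then obtain x where x: "x \<in> relations (VJ m J) L" "z = pull m \<alpha> x" by blast
    have "lincomb ?\<sigma> x L \<in> {lincomb ?\<sigma> c L | c. True}" by blast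
    then have 0: "mat_apply n ?N M (lincomb ?\<sigma> x L) = (\<lambda>_. 0)" unfolding ker[symmetric] by simp
    have "mat_apply n ?N M (lincomb (VJ m J) x L) = (\<lambda>_. 0)"
      using x(1) by (simp add: relations_def mat_apply_zero)
    then have "lincomb {1..m} z l = (\<lambda>_. 0)"
      unfolding lincomb_VJ[OF \<alpha>] mat_apply_add 0 x(2) Mlin by simp
    then show "z \<in> relations {1..m} l" using x(2) by (auto simp: relations_def supported_on_def pull_def)
  next
    fix z assume z: "z \<in> relations {1..m} l"
    let ?w = "lincomb {1..m} z (\<lambda>i. L (i, \<alpha> i))"
    have "?w \<in> vec ?N"
      using L \<alpha> by (intro lincomb_in_vec) (auto simp: char_map_def VJ_def IJ_def)
    moreover have "mat_apply n ?N M ?w = (\<lambda>_. 0)"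
      unfolding Mlin using z by (simp add: relations_def)
    ultimately have "?w \<in> {x\<in>vec ?N. mat_apply n ?N M x = (\<lambda>_. 0)}" by simp
    then obtain c where c: "?w = lincomb ?\<sigma> c L" unfolding ker by blast
    define x where "x = (\<lambda>u. if u \<in> section_set \<alpha> {1..m} then z (fst u) else
       if u \<in> VJ m J then - c u else 0)"
    have px: "pull m \<alpha> x = z"
      using z by (auto simp: pull_def x_def section_set_def relations_def supported_on_def)
    have "lincomb ?\<sigma> x L = lincomb ?\<sigma> (\<lambda>u. (- 1) * c u) L"
      by (intro lincomb_cong) (auto simp: x_def sigma_alpha_eq)
    then have "lincomb ?\<sigma> x L = (\<lambda>i. - lincomb ?\<sigma> c L i)" unfolding lincomb_scale by simp
    then have "lincomb (VJ m J) x L = (\<lambda>_. 0)"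
      unfolding lincomb_VJ[OF \<alpha>] px c by simp
    moreover have "x \<in> supported_on (VJ m J)"
      using section_set_subset[OF \<alpha>, of "{1..m}"] by (auto simp: supported_on_def x_def)
    ultimately have "x \<in> relations (VJ m J) L" by (simp add: relations_def)
    then show "z \<in> pull m \<alpha> ` relations (VJ m J) L" using px by blast
  }
qed

text \<open>\<open>M\<close> is prescribed on the basis at a facet containing
  \<open>\<sigma>(\<alpha>)\<close>: zero on \<open>\<sigma>(\<alpha>)\<close>, and
  \<open>l i\<close> at \<open>(i, \<alpha> i)\<close> for \<open>i\<close> in
  \<open>\<tau>\<close>. Surjectivity and the kernel follow from the two bases; only the vertices
  off \<open>\<tau>\<close> need the hypothesis on relations.\<close>

lemma exists_proj:
  assumes J: "\<forall>i\<in>{1..m}. 0 < J i" and L: "char_mapJ J L" and \<alpha>: "\<alpha> \<in> IJ m J"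
    and l: "char_map K {1..m} n l"
    and rel: "relations {1..m} l = pull m \<alpha> ` relations (VJ m J) L"
  shows "\<exists>M. (\<forall>y\<in>vec n. \<exists>x\<in>vec (dimJ m n J). mat_apply n (dimJ m n J) M x = y) \<and>
             {x\<in>vec (dimJ m n J). mat_apply n (dimJ m n J) M x = (\<lambda>_. 0)}
                = {lincomb (sigma_alpha m J \<alpha>) c L | c. True} \<and>
             (\<forall>i\<in>{1..m}. l i = mat_apply n (dimJ m n J) M (L (i, \<alpha> i)))"
proof -
  let ?N = "dimJ m n J" and ?\<sigma> = "sigma_alpha m J \<alpha>"
  obtain \<tau> where \<tau>: "\<tau> \<in> K" "card \<tau> = n" using facet_exists by blast
  have \<tau>m: "\<tau> \<subseteq> {1..m}" using \<tau> face_subset by blast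
  let ?F = "facet_J m J \<tau> \<alpha>"
  have finF: "finite ?F" and FV: "?F \<subseteq> VJ m J" using finite_VJ by (auto simp: facet_J_def)
  have Lvec: "L u \<in> vec ?N" if "u \<in> VJ m J" for u using L that by (simp add: char_map_def)
  have \<sigma>V: "?\<sigma> \<subseteq> VJ m J" by (auto simp: sigma_alpha_def)
  have bF: "is_basis_family ?N ?F L"
    using L facet_J_in_KJ[OF J \<tau> \<alpha>] by (simp add: char_map_def)
  have b\<tau>: "is_basis_family n \<tau> l" using l \<tau> by (simp add: char_map_def)
  have lvec: "l i \<in> vec n" if "i \<in> {1..m}" for i using l that by (simp add: char_map_def)
  obtain M where M: "\<And>u. u \<in> ?F \<Longrightarrow> mat_apply n ?N M (L u) = (if u \<in> ?\<sigma> then (\<lambda>_. 0) else l (fst u))"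
  proof (rule exists_mat_on_basis[OF finF bF])
    show "(if u \<in> ?\<sigma> then (\<lambda>_. 0) else l (fst u)) \<in> vec n" if "u \<in> ?F" for u
      using that lvec FV by (cases u) (auto simp: vec_def VJ_def)
  qed blast
  have M\<sigma>: "mat_apply n ?N M (lincomb ?\<sigma> c L) = (\<lambda>_. 0)" for c
  proof -
    have "mat_apply n ?N M (lincomb ?\<sigma> c L) = lincomb ?\<sigma> c (\<lambda>_ _. 0)"
      unfolding mat_apply_lincomb using M facet_J_eq(1)[OF \<alpha> \<tau>m] by (intro lincomb_cong) auto
    then show ?thesis by (simp add: lincomb_def)
  qed
  have M\<tau>: "mat_apply n ?N M (lincomb \<tau> c (\<lambda>i. L (i, \<alpha> i))) = lincomb \<tau> c l" for c
    unfolding mat_apply_lincomb using M facet_J_eq[OF \<alpha> \<tau>m]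
    by (intro lincomb_cong) (auto simp: section_set_def sigma_alpha_eq)
  have MF: "mat_apply n ?N M (lincomb ?F c L) = lincomb \<tau> (\<lambda>i. c (i, \<alpha> i)) l" for c
    unfolding lincomb_facet_J[OF \<alpha> \<tau>m] mat_apply_add M\<sigma> M\<tau> by simp
  have "\<exists>x\<in>vec ?N. mat_apply n ?N M x = y" if y: "y \<in> vec n" for y
  proof -
    obtain b where b: "y = lincomb \<tau> b l" using basis_expansion[OF b\<tau> y] .
    have "lincomb \<tau> b (\<lambda>i. L (i, \<alpha> i)) \<in> vec ?N"
      using Lvec section_set_subset[OF \<alpha> \<tau>m] by (intro lincomb_in_vec) (auto simp: section_set_def)
    then show ?thesis using M\<tau> b by blast
  qed
  moreover have "{x\<in>vec ?N. mat_apply n ?N M x = (\<lambda>_. 0)} = {lincomb ?\<sigma> c L | c. True}"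
  proof (intro set_eqI iffI)
    fix x assume "x \<in> {x\<in>vec ?N. mat_apply n ?N M x = (\<lambda>_. 0)}"
    then have x: "x \<in> vec ?N" "mat_apply n ?N M x = (\<lambda>_. 0)" by auto
    obtain c where c: "x = lincomb ?F c L" using basis_expansion[OF bF x(1)] .
    have "lincomb \<tau> (\<lambda>i. c (i, \<alpha> i)) l = (\<lambda>_. 0)" using x(2) unfolding c MF .
    then have "\<forall>i\<in>\<tau>. c (i, \<alpha> i) = 0" by (rule basis_independent[OF b\<tau>])
    then have "lincomb \<tau> (\<lambda>i. c (i, \<alpha> i)) (\<lambda>i. L (i, \<alpha> i)) = (\<lambda>_. 0)"
      by (simp add: lincomb_def)
    then have "x = lincomb ?\<sigma> c L" unfolding c lincomb_facet_J[OF \<alpha> \<tau>m] by simp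
    then show "x \<in> {lincomb ?\<sigma> c L | c. True}" by blast
  next
    fix x assume "x \<in> {lincomb ?\<sigma> c L | c. True}"
    then obtain c where c: "x = lincomb ?\<sigma> c L" by blast
    have "x \<in> vec ?N" unfolding c using Lvec \<sigma>V by (intro lincomb_in_vec) blast
    then show "x \<in> {x\<in>vec ?N. mat_apply n ?N M x = (\<lambda>_. 0)}" using M\<sigma> c by simp
  qed
  moreover have "l i = mat_apply n ?N M (L (i, \<alpha> i))" if i: "i \<in> {1..m}" for i
  proof (cases "i \<in> \<tau>")
    case True
    then have "(i, \<alpha> i) \<in> ?F" "(i, \<alpha> i) \<notin> ?\<sigma>"
      using facet_J_eq[OF \<alpha> \<tau>m] by (auto simp: section_set_def)
    then show ?thesis using M by simp
  next
    case False
    have iV: "(i, \<alpha> i) \<in> VJ m J" using \<alpha> i by (auto simp: VJ_def IJ_def)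
    obtain c where c: "L (i, \<alpha> i) = lincomb ?F c L" using basis_expansion[OF bF Lvec[OF iV]] .
    \<comment> \<open>The expansion of \<open>L (i, \<alpha> i)\<close> in the facet, rewritten as a
      relation; its pullback is the matching expansion of \<open>l i\<close> over
      \<open>\<tau>\<close>.\<close>
    let ?x = "\<lambda>u. (if u = (i, \<alpha> i) then 1 else 0) - (if u \<in> ?F then c u else 0)"
    have "?x \<in> relations (VJ m J) L"
      using c expansion_iff_relation[OF finite_VJ FV iV] by blast
    then have "pull m \<alpha> ?x \<in> relations {1..m} l" unfolding rel by (rule imageI)
    moreover have "(j, \<alpha> j) \<in> ?F \<longleftrightarrow> j \<in> \<tau>" if "j \<in> {1..m}" for j
      using that \<alpha> by (auto simp: facet_J_def section_set_def VJ_def IJ_def)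
    then have "pull m \<alpha> ?x = (\<lambda>j. (if j = i then 1 else 0) - (if j \<in> \<tau> then c (j, \<alpha> j) else 0))"
      using i \<tau>m by (auto simp: pull_def fun_eq_iff)
    ultimately have "l i = lincomb \<tau> (\<lambda>j. c (j, \<alpha> j)) l"
      using expansion_iff_relation[OF _ \<tau>m i, of l "\<lambda>j. c (j, \<alpha> j)"] by simp
    then show ?thesis unfolding c MF .
  qed
  ultimately show ?thesis by (intro exI[of _ M]) simp
qed

lemma proj_class_eq:
  assumes J: "\<forall>i\<in>{1..m}. 0 < J i" and L: "char_mapJ J L" and \<alpha>: "\<alpha> \<in> IJ m J"
  shows "proj_class K m n J L \<alpha> = class_of (pull m \<alpha> ` relations (VJ m J) L)"
  unfolding proj_class_def class_of_def
proof (intro Collect_cong conj_cong refl iffI)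
  fix l assume "\<exists>M. (\<forall>y\<in>vec n. \<exists>x\<in>vec (dimJ m n J). mat_apply n (dimJ m n J) M x = y) \<and>
             {x\<in>vec (dimJ m n J). mat_apply n (dimJ m n J) M x = (\<lambda>_. 0)}
                = {lincomb (sigma_alpha m J \<alpha>) c L | c. True} \<and>
             (\<forall>i\<in>{1..m}. l i = mat_apply n (dimJ m n J) M (L (i, \<alpha> i)))"
  then show "relations {1..m} l = pull m \<alpha> ` relations (VJ m J) L"
    by (elim exE conjE) (rule relations_of_proj[OF L \<alpha>], assumption, simp)
qed (rule exists_proj[OF J L \<alpha>])

section \<open>D-J classes, realizations and edges in terms of modules\<close>

lemma exists_char_mapK:
  assumes "char_relK A"
  obtains l where "char_map K {1..m} n l" "relations {1..m} l = A"
  using facet_exists face_subset exists_char_map[of "{1..m}" K _ n A] assms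
  by (metis finite_atLeastAtMost)

lemma KJ_subset: "\<sigma> \<in> KJ K m J \<Longrightarrow> \<sigma> \<subseteq> VJ m J"
  by (simp add: KJ_def)

lemma KJ_facet_exists:
  assumes J: "\<forall>i\<in>{1..m}. 0 < J i"
  shows "\<exists>\<sigma>\<in>KJ K m J. card \<sigma> = dimJ m n J"
  using facet_exists facet_J_in_KJ[OF J _ _ IJ_nonempty[OF J]] by blast

lemma exists_char_mapJ:
  assumes J: "\<forall>i\<in>{1..m}. 0 < J i" and "char_relJ J P"
  obtains L where "char_mapJ J L" "relations (VJ m J) L = P"
  using KJ_facet_exists[OF J] KJ_subset exists_char_map[of "VJ m J" "KJ K m J" _ _ P] assms(2)
    finite_VJ by metis

lemma char_relJ_relations:
  assumes "char_mapJ J L"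
  shows "char_relJ J (relations (VJ m J) L)"
  using char_relations_of_char_map[OF finite_VJ KJ_subset assms] .

lemma char_relK_relations: "char_map K {1..m} n l \<Longrightarrow> char_relK (relations {1..m} l)"
  using char_relations_of_char_map[OF _ face_subset] by blast

text \<open>The class of a characteristic module is nonempty, and any member recovers the
  module.\<close>

lemma class_of_inject:
  assumes "char_relK A" "class_of A = class_of B"
  shows "A = B"
proof -
  obtain l where l: "char_map K {1..m} n l" "relations {1..m} l = A"
    using exists_char_mapK[OF assms(1)] .
  then have "l \<in> class_of B" unfolding assms(2)[symmetric] by (simp add: class_of_def)
  then show ?thesis using l by (simp add: class_of_def)
qed

lemma DJ_class_eq:
  assumes "char_map K {1..m} n l"
  shows "DJ_class K m n l = class_of (relations {1..m} l)"
proof -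
  obtain \<tau> where "\<tau> \<in> K" "card \<tau> = n" using facet_exists by blast
  then have "DJ_equiv {1..m} n l \<mu> \<longleftrightarrow> relations {1..m} l = relations {1..m} \<mu>"
    if "char_map K {1..m} n \<mu>" for \<mu>
    using DJ_equiv_iff_relations[OF _ face_subset _ _ assms that] by simp
  then show ?thesis by (auto simp: DJ_class_def class_of_def)
qed

lemma DJ_classes_eq: "DJ_classes K m n = class_of ` {A. char_relK A}"
proof (intro set_eqI iffI)
  fix c assume "c \<in> DJ_classes K m n"
  then obtain l where "char_map K {1..m} n l" "c = class_of (relations {1..m} l)"
    by (auto simp: DJ_classes_def DJ_class_eq)
  then show "c \<in> class_of ` {A. char_relK A}" using char_relK_relations by auto
next
  fix c assume "c \<in> class_of ` {A. char_relK A}"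
  then obtain A where A: "char_relK A" "c = class_of A" by blast
  obtain l where "char_map K {1..m} n l" "relations {1..m} l = A" using exists_char_mapK[OF A(1)] .
  then show "c \<in> DJ_classes K m n" using A DJ_class_eq by (force simp: DJ_classes_def)
qed

text \<open>Removes matrices and projections from the notion of realizability, so that puzzles can
  be treated through modules and pullbacks alone.\<close>

lemma realizable_iff:
  assumes J: "\<forall>i\<in>{1..m}. 0 < J i"
  shows "realizable K m n J p \<longleftrightarrow>
    (\<exists>P. char_relJ J P \<and> (\<forall>\<alpha>\<in>IJ m J. p \<alpha> = class_of (pull m \<alpha> ` P)))"
proof
  assume "realizable K m n J p"
  then obtain L where "char_mapJ J L" "\<And>\<alpha>. \<alpha> \<in> IJ m J \<Longrightarrow> p \<alpha> = proj_class K m n J L \<alpha>"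
    unfolding realizable_def by metis
  then show "\<exists>P. char_relJ J P \<and> (\<forall>\<alpha>\<in>IJ m J. p \<alpha> = class_of (pull m \<alpha> ` P))"
    by (intro exI[of _ "relations (VJ m J) L"]) (simp add: proj_class_eq[OF J] char_relJ_relations)
next
  assume "\<exists>P. char_relJ J P \<and> (\<forall>\<alpha>\<in>IJ m J. p \<alpha> = class_of (pull m \<alpha> ` P))"
  then obtain P where P: "char_relJ J P" "\<And>\<alpha>. \<alpha> \<in> IJ m J \<Longrightarrow> p \<alpha> = class_of (pull m \<alpha> ` P)"
    by blast
  obtain L where "char_mapJ J L" "relations (VJ m J) L = P" using exists_char_mapJ[OF J P(1)] .
  then show "realizable K m n J p"
    unfolding realizable_def using P(2) by (intro exI[of _ L]) (simp add: proj_class_eq[OF J])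
qed

lemma wedgeJ_pos: "\<forall>i\<in>{1..m}. 0 < wedgeJ v i"
  by (simp add: wedgeJ_def)

lemma wedge_alpha_IJ:
  assumes "a \<in> {1, 2}"
  shows "wedge_alpha m v a \<in> IJ m (wedgeJ v)"
  using assms by (auto simp: wedge_alpha_def IJ_def wedgeJ_def)

lemma D_edge_dir_iff:
  "D_edge_dir K m n TYPE('r::comm_ring_1) v c1 c2 \<longleftrightarrow>
    (\<exists>P. char_relJ (wedgeJ v) P \<and> c1 = class_of (pull m (wedge_alpha m v 2) ` P)
      \<and> c2 = class_of (pull m (wedge_alpha m v 1) ` P))"
proof
  assume "D_edge_dir K m n TYPE('r) v c1 c2"
  then obtain L where "char_mapJ (wedgeJ v) L"
    "c1 = proj_class K m n (wedgeJ v) L (wedge_alpha m v 2)"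
    "c2 = proj_class K m n (wedgeJ v) L (wedge_alpha m v 1)"
    unfolding D_edge_dir_def by metis
  then show "\<exists>P. char_relJ (wedgeJ v) P \<and> c1 = class_of (pull m (wedge_alpha m v 2) ` P)
      \<and> c2 = class_of (pull m (wedge_alpha m v 1) ` P)"
    by (intro exI[of _ "relations (VJ m (wedgeJ v)) L"])
      (simp add: proj_class_eq[OF wedgeJ_pos] wedge_alpha_IJ char_relJ_relations)
next
  assume "\<exists>P. char_relJ (wedgeJ v) P \<and> c1 = class_of (pull m (wedge_alpha m v 2) ` P)
      \<and> c2 = class_of (pull m (wedge_alpha m v 1) ` P)"
  then obtain P where P: "char_relJ (wedgeJ v) P" "c1 = class_of (pull m (wedge_alpha m v 2) ` P)"
      "c2 = class_of (pull m (wedge_alpha m v 1) ` P)" by blast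
  obtain L where "char_mapJ (wedgeJ v) L" "relations (VJ m (wedgeJ v)) L = P"
    using exists_char_mapJ[OF wedgeJ_pos P(1)] .
  then show "D_edge_dir K m n TYPE('r) v c1 c2"
    unfolding D_edge_dir_def using P
    by (intro exI[of _ L]) (simp add: proj_class_eq[OF wedgeJ_pos] wedge_alpha_IJ)
qed

subsection \<open>Puzzles\<close>


text \<open>Pullbacks of the reindexed module along \<open>\<alpha>\<close> are pullbacks of
  \<open>P\<close> along the composite of \<open>s\<close> with \<open>\<alpha>\<close>, so
  \<open>char_relJ_of_pull\<close> applies.\<close>

lemma char_relJ_reindex:
  assumes J: "\<forall>i\<in>{1..m}. 0 < J i" and J': "\<forall>i\<in>{1..m}. 0 < J' i"
    and s: "\<And>i k. i \<in> {1..m} \<Longrightarrow> 1 \<le> k \<Longrightarrow> k \<le> J' i \<Longrightarrow> 1 \<le> s i k \<and> s i k \<le> J i"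
    and P: "char_relJ J P"
  shows "char_relJ J' (reindex m J' s ` P)"
proof (rule char_relJ_of_pull[OF J'])
  show "submodule (reindex m J' s ` P)"
    using P by (intro submodule_reindex) (simp add: char_relations_def)
  show "reindex m J' s ` P \<subseteq> supported_on (VJ m J')"
    by (auto simp: reindex_def supported_on_def)
  fix \<alpha> assume \<alpha>: "\<alpha> \<in> IJ m J'"
  then have "(\<lambda>i. if i \<in> {1..m} then s i (\<alpha> i) else 0) \<in> IJ m J"
    using s by (auto simp: IJ_def)
  then show "char_relK (pull m \<alpha> ` reindex m J' s ` P)"
    using char_relK_pull[OF J P] by (simp add: image_image pull_reindex[OF \<alpha>])
qed

text \<open>Both ends of an edge are pullbacks of one module over the wedge, along sections that
  differ only in the fibre of \<open>v\<close>. Pulling back a common preimage changes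
  \<open>x\<close> at \<open>v\<close> alone.\<close>

lemma D_edge_lift:
  assumes A: "char_relK A" "char_relK B"
    and e: "D_edge K m n v (class_of A) (class_of B)" and x: "x \<in> A"
  shows "\<exists>y\<in>B. \<forall>i. i \<noteq> v \<longrightarrow> y i = x i"
proof -
  have "\<exists>P a b. A = pull m (wedge_alpha m v a) ` P \<and> B = pull m (wedge_alpha m v b) ` P"
    using e class_of_inject[OF A(1)] class_of_inject[OF A(2)]
    unfolding D_edge_def D_edge_dir_iff by metis
  then obtain P a b where P: "A = pull m (wedge_alpha m v a) ` P" "B = pull m (wedge_alpha m v b) ` P"
    by blast
  obtain z where "z \<in> P" "x = pull m (wedge_alpha m v a) z" using P x by blast
  then show ?thesis
    using P(2) by (intro bexI[of _ "pull m (wedge_alpha m v b) z"]) (auto simp: pull_def wedge_alpha_def)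
qed

text \<open>A subpuzzle is realized by reindexing the module of the whole puzzle along the
  increasing enumerations of the sets \<open>S i\<close>.\<close>

lemma realizable_imp_subsquares:
  assumes J: "\<forall>i\<in>{1..m}. 0 < J i" and r: "realizable K m n J p"
  shows "all_subsquares_realizable K m n J p"
  unfolding all_subsquares_realizable_def
proof (intro allI impI)
  fix S assume "is_subsquare_sel m J S"
  then have S: "S i \<noteq> {}" "S i \<subseteq> {1..J i}" if "i \<in> {1..m}" for i
    using that by (auto simp: is_subsquare_sel_def valid_sel_def)
  have fin: "finite (S i)" if "i \<in> {1..m}" for i using S(2)[OF that] finite_subset by blast
  have J': "\<forall>i\<in>{1..m}. 0 < sel_J S i" using S(1) fin by (simp add: sel_J_def card_gt_0_iff)
  define s where "s = (\<lambda>i k. sorted_list_of_set (S i) ! (k - 1))"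
  have s: "1 \<le> s i k \<and> s i k \<le> J i" if "i \<in> {1..m}" "1 \<le> k" "k \<le> sel_J S i" for i k
  proof -
    have "s i k \<in> set (sorted_list_of_set (S i))"
      unfolding s_def using that by (intro nth_mem) (simp add: sel_J_def)
    then show ?thesis using S(2) fin that(1) by force
  qed
  obtain P where P: "char_relJ J P" "\<And>\<alpha>. \<alpha> \<in> IJ m J \<Longrightarrow> p \<alpha> = class_of (pull m \<alpha> ` P)"
    using r unfolding realizable_iff[OF J] by blast
  have "subpuzzle m S p \<alpha> = class_of (pull m \<alpha> ` reindex m (sel_J S) s ` P)"
    if \<alpha>: "\<alpha> \<in> IJ m (sel_J S)" for \<alpha>
  proof -
    let ?\<beta> = "\<lambda>i. if i \<in> {1..m} then s i (\<alpha> i) else 0"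
    have "?\<beta> \<in> IJ m J" using s \<alpha> by (auto simp: IJ_def)
    moreover have "subpuzzle m S p \<alpha> = p ?\<beta>" unfolding subpuzzle_def s_def ..
    ultimately show ?thesis
      using P(2) by (simp only: image_image pull_reindex[OF \<alpha>])
  qed
  moreover have "char_relJ (sel_J S) (reindex m (sel_J S) s ` P)"
    by (rule char_relJ_reindex[OF J J' s P(1)])
  ultimately show "realizable K m n (sel_J S) (subpuzzle m S p)"
    unfolding realizable_iff[OF J'] by blast
qed

text \<open>An element at the corner opposite \<open>\<alpha>\<close> extends over the realized
  square. Its extension is given as \<open>f i c\<close>, with \<open>c\<close> an original index of
  \<open>J\<close> rather than a position in the sorted list of \<open>S i\<close>.\<close>

lemma square_extension:
  assumes sq: "all_subsquares_realizable K m n J p"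
    and A: "\<And>\<alpha>. \<alpha> \<in> IJ m J \<Longrightarrow> char_relK (A \<alpha>) \<and> p \<alpha> = class_of (A \<alpha>)"
    and \<alpha>: "\<alpha> \<in> IJ m J" and vw: "v \<in> {1..m}" "w \<in> {1..m}" "v \<noteq> w"
    and a: "a \<in> {1..J v}" "a \<noteq> \<alpha> v" and b: "b \<in> {1..J w}" "b \<noteq> \<alpha> w"
    and z: "z \<in> A (\<alpha>(v := a, w := b))"
  obtains f where "z = (\<lambda>i. if i \<in> {1..m} then f i ((\<alpha>(v := a, w := b)) i) else 0)"
    "\<And>\<beta>. \<beta> \<in> {\<alpha>, \<alpha>(v := a), \<alpha>(w := b)} \<Longrightarrow> (\<lambda>i. if i \<in> {1..m} then f i (\<beta> i) else 0) \<in> A \<beta>"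
proof -
  define S where "S = (\<lambda>i. if i = v then {a, \<alpha> v} else if i = w then {b, \<alpha> w} else {\<alpha> i})"
  have \<alpha>b: "1 \<le> \<alpha> i \<and> \<alpha> i \<le> J i" if "i \<in> {1..m}" for i using \<alpha> that by (simp add: IJ_def)
  have sub: "S i \<noteq> {} \<and> S i \<subseteq> {1..J i}" if "i \<in> {1..m}" for i
    using that \<alpha>b[OF that] a b by (auto simp: S_def)
  have fin: "finite (S i)" for i by (simp add: S_def)
  have "card (S i) = (if i = v \<or> i = w then 2 else 1)" for i
    using a b by (simp add: S_def)
  then have "{i \<in> {1..m}. card (S i) = 2} = {v, w}" and c2: "\<forall>i\<in>{1..m}. card (S i) \<le> 2"
    using vw by auto
  then have "is_subsquare_sel m J S"
    using sub vw by (simp add: is_subsquare_sel_def valid_sel_def)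
  then have r: "realizable K m n (sel_J S) (subpuzzle m S p)"
    using sq by (simp add: all_subsquares_realizable_def)
  have J': "\<forall>i\<in>{1..m}. 0 < sel_J S i" using sub fin by (simp add: sel_J_def card_gt_0_iff)
  obtain Q where Q: "char_relJ (sel_J S) Q"
    "\<And>\<beta>. \<beta> \<in> IJ m (sel_J S) \<Longrightarrow> subpuzzle m S p \<beta> = class_of (pull m \<beta> ` Q)"
    using r unfolding realizable_iff[OF J'] by blast
  \<comment> \<open>\<open>idx i\<close> inverts the sorted enumeration of \<open>S i\<close>;
    indices of \<open>J\<close> start at 1 and list positions at 0, hence
    \<open>k - 1\<close>.\<close>
  have "\<forall>i c. \<exists>k. c \<in> S i \<longrightarrow> 1 \<le> k \<and> k \<le> card (S i) \<and> sorted_list_of_set (S i) ! (k - 1) = c"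
    using sorted_list_index[OF fin] by blast
  then obtain idx where idx: "\<And>i c. c \<in> S i \<Longrightarrow>
      1 \<le> idx i c \<and> idx i c \<le> card (S i) \<and> sorted_list_of_set (S i) ! (idx i c - 1) = c"
    by metis
  have corner: "A \<beta> = pull m (\<lambda>i. if i \<in> {1..m} then idx i (\<beta> i) else 0) ` Q"
    if \<beta>: "\<beta> \<in> IJ m J" "\<And>i. i \<in> {1..m} \<Longrightarrow> \<beta> i \<in> S i" for \<beta>
  proof (rule class_of_inject)
    show "char_relK (A \<beta>)" using A \<beta>(1) by blast
    let ?\<beta> = "\<lambda>i. if i \<in> {1..m} then idx i (\<beta> i) else 0"
    have "?\<beta> \<in> IJ m (sel_J S)" using idx \<beta>(2) by (auto simp: IJ_def sel_J_def)
    then have 1: "class_of (pull m ?\<beta> ` Q) = subpuzzle m S p ?\<beta>" using Q(2) by simp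
    have "(\<lambda>i. if i \<in> {1..m} then sorted_list_of_set (S i) ! (?\<beta> i - 1) else 0) = \<beta>"
      using idx \<beta> by (auto simp: IJ_def fun_eq_iff)
    then have "subpuzzle m S p ?\<beta> = p \<beta>" unfolding subpuzzle_def by (rule arg_cong)
    then show "class_of (A \<beta>) = class_of (pull m ?\<beta> ` Q)" using 1 A \<beta>(1) by simp
  qed
  have IJ: "\<alpha>(v := a) \<in> IJ m J" "\<alpha>(w := b) \<in> IJ m J" "\<alpha>(v := a, w := b) \<in> IJ m J"
    using \<alpha> a b vw by (auto intro!: IJ_update)
  have "(\<alpha>(v := a, w := b)) i \<in> S i" for i using vw by (simp add: S_def)
  then have "A (\<alpha>(v := a, w := b))
      = pull m (\<lambda>i. if i \<in> {1..m} then idx i ((\<alpha>(v := a, w := b)) i) else 0) ` Q"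
    using corner[OF IJ(3)] by blast
  then obtain X where X: "X \<in> Q"
    "z = pull m (\<lambda>i. if i \<in> {1..m} then idx i ((\<alpha>(v := a, w := b)) i) else 0) X"
    using z by blast
  show ?thesis
  proof (rule that[of "\<lambda>i c. X (i, idx i c)"])
    show "z = (\<lambda>i. if i \<in> {1..m} then X (i, idx i ((\<alpha>(v := a, w := b)) i)) else 0)"
      unfolding X(2) by (auto simp: pull_def)
    fix \<beta> assume \<beta>: "\<beta> \<in> {\<alpha>, \<alpha>(v := a), \<alpha>(w := b)}"
    then have "\<beta> \<in> IJ m J" using IJ \<alpha> by blast
    moreover have "\<beta> i \<in> S i" for i using \<beta> vw by (auto simp: S_def)
    ultimately have "pull m (\<lambda>i. if i \<in> {1..m} then idx i (\<beta> i) else 0) X \<in> A \<beta>"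
      using corner X(1) by blast
    moreover have "pull m (\<lambda>i. if i \<in> {1..m} then idx i (\<beta> i) else 0) X
        = (\<lambda>i. if i \<in> {1..m} then X (i, idx i (\<beta> i)) else 0)"
      by (auto simp: pull_def)
    ultimately show "(\<lambda>i. if i \<in> {1..m} then X (i, idx i (\<beta> i)) else 0) \<in> A \<beta>" by simp
  qed
qed

text \<open>Supplies surjectivity of the pullback from the candidate module onto
  \<open>A base\<close>. The base is left arbitrary because every multi-index takes its place in
  turn.\<close>

lemma exists_global_section:
  assumes puz: "is_puzzle K m n J p" and sq: "all_subsquares_realizable K m n J p"
    and A: "\<And>\<alpha>. \<alpha> \<in> IJ m J \<Longrightarrow> char_relK (A \<alpha>) \<and> p \<alpha> = class_of (A \<alpha>)"
    and o: "base \<in> IJ m J" and x: "x \<in> A base"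
  shows "\<exists>X\<in>supported_on (VJ m J). pull m base X = x \<and> (\<forall>\<alpha>\<in>IJ m J. pull m \<alpha> X \<in> A \<alpha>)"
proof -
  have x0: "x i = 0" if "i \<notin> {1..m}" for i
    using that x A[OF o] by (auto simp: char_relations_def supported_on_def)
  have "\<exists>y. y \<in> A (base(v := k)) \<and> (\<forall>i. i \<noteq> v \<longrightarrow> y i = x i)" if vk: "(v, k) \<in> VJ m J" for v k
  proof (cases "k = base v")
    case True
    then show ?thesis using x by (intro exI[of _ x]) simp
  next
    case False
    have v: "v \<in> {1..m}" and o1: "base(v := k) \<in> IJ m J"
      using vk IJ_update[OF o] by (auto simp: VJ_def)
    have "D_edge K m n v (p base) (p (base(v := k)))"
      using puz o o1 v False by (auto simp: is_puzzle_def)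
    then show ?thesis using D_edge_lift[of "A base" "A (base(v := k))" v x] A o o1 x by auto
  qed
  then obtain Y where Y: "\<And>v k. (v, k) \<in> VJ m J \<Longrightarrow> Y v k \<in> A (base(v := k))"
    "\<And>v k i. (v, k) \<in> VJ m J \<Longrightarrow> i \<noteq> v \<Longrightarrow> Y v k i = x i" by metis
  \<comment> \<open>\<open>Y v k\<close> is the lift of \<open>x\<close> along the edge that changes
    coordinate \<open>v\<close> of \<open>base\<close> to \<open>k\<close>. Only its value at
    \<open>v\<close> is new, and this is the value that any extension of \<open>x\<close> must take
    at \<open>(v, k)\<close>.\<close>
  define X where "X = (\<lambda>(v, k). if (v, k) \<in> VJ m J then Y v k v else 0)"
  have VJ: "(i, \<alpha> i) \<in> VJ m J" if "\<alpha> \<in> IJ m J" "i \<in> {1..m}" for i \<alpha>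
    using that by (auto simp: IJ_def VJ_def)
  \<comment> \<open>For the unchanged index the chosen lift agrees with \<open>x\<close> off
    \<open>v\<close> inside \<open>A base\<close>, hence equals it.\<close>
  have "Y v (base v) = x" if v: "v \<in> {1..m}" for v
    using Y[OF VJ[OF o v]] x A[OF o] v by (intro char_relK_determined[of "A base"]) auto
  then have Xo: "X (v, base v) = x v" if "v \<in> {1..m}" for v
    using VJ[OF o that] that by (simp add: X_def)
  have po: "pull m base X = x" using x0 Xo by (auto simp: pull_def)
  have "pull m \<alpha> X \<in> A \<alpha>" if "\<alpha> \<in> IJ m J" for \<alpha>
    using that
  proof (induction "card {i \<in> {1..m}. \<alpha> i \<noteq> base i}" arbitrary: \<alpha> rule: less_induct)
    case less
    have eq: "\<alpha> i = base i" if "i \<notin> {1..m}" for i using less.prems o that by (auto simp: IJ_def)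
    consider "\<alpha> = base" | v where "v \<in> {1..m}" "\<alpha> = base(v := \<alpha> v)"
      | v w where "v \<in> {1..m}" "w \<in> {1..m}" "v \<noteq> w" "\<alpha> v \<noteq> base v" "\<alpha> w \<noteq> base w"
    proof (cases "\<alpha> = base")
      case False
      then obtain v where v: "\<alpha> v \<noteq> base v" by blast
      then have vm: "v \<in> {1..m}" using eq by blast
      show ?thesis
      proof (cases "\<alpha> = base(v := \<alpha> v)")
        case False
        then obtain w where "w \<noteq> v" "\<alpha> w \<noteq> base w" by (auto simp: fun_eq_iff split: if_splits)
        then show ?thesis using that(3)[of v w] v vm eq by blast
      qed (use that(2) vm in blast)
    qed (use that(1) in blast)
    then show ?case
    proof cases
      case 1
      then show ?thesis using po x by simp
    next
      case (2 v)
      have vk: "(v, \<alpha> v) \<in> VJ m J" using VJ[OF less.prems 2(1)] .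
      have off: "\<alpha> i = base i" if "i \<noteq> v" for i using fun_cong[OF 2(2), of i] that by simp
      have "pull m \<alpha> X i = Y v (\<alpha> v) i" for i
        using Y(2)[OF vk, of i] off[of i] Xo[of i] x0[of i] vk 2(1)
        by (cases "i = v") (auto simp: pull_def X_def)
      then have "pull m \<alpha> X = Y v (\<alpha> v)" by blast
      then show ?thesis using Y(1)[OF vk] 2(2) by simp
    next
      case (3 v w)
      have smaller: "card {i \<in> {1..m}. \<beta> i \<noteq> base i} < card {i \<in> {1..m}. \<alpha> i \<noteq> base i}"
        if "\<And>i. \<beta> i \<noteq> base i \<Longrightarrow> \<alpha> i \<noteq> base i" "u \<in> {1..m}" "\<beta> u = base u" "\<alpha> u \<noteq> base u" for \<beta> u
        using that by (intro psubset_card_mono) auto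
      have ov: "base v \<in> {1..J v}" "base w \<in> {1..J w}" using o 3 by (auto simp: IJ_def)
      \<comment> \<open>Resetting \<open>v\<close>, \<open>w\<close> or both to \<open>base\<close>
        gives the other three corners of a square at \<open>\<alpha>\<close>, all closer to
        \<open>base\<close>. The square is filled starting from the corner \<open>?vw\<close>
        opposite \<open>\<alpha>\<close>.\<close>
      let ?vw = "\<alpha>(v := base v, w := base w)" and ?v = "\<alpha>(v := base v)" and ?w = "\<alpha>(w := base w)"
      have IJ: "?v \<in> IJ m J" "?w \<in> IJ m J" "?vw \<in> IJ m J"
        using less.prems ov 3 by (auto intro!: IJ_update)
      have IH: "pull m ?v X \<in> A ?v" "pull m ?w X \<in> A ?w" "pull m ?vw X \<in> A ?vw"
        by (rule less.hyps[OF smaller[of _ v] IJ(1)] less.hyps[OF smaller[of _ w] IJ(2)]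
            less.hyps[OF smaller[of _ w] IJ(3)]; use 3 in \<open>auto split: if_splits\<close>)+
      obtain f where f: "pull m ?vw X = (\<lambda>i. if i \<in> {1..m} then f i (?vw i) else 0)"
        "\<And>\<beta>. \<beta> \<in> {\<alpha>, ?v, ?w} \<Longrightarrow> (\<lambda>i. if i \<in> {1..m} then f i (\<beta> i) else 0) \<in> A \<beta>"
        \<comment> \<open>At the corners \<open>?v\<close> and \<open>?w\<close> the square agrees with \<open>X\<close> off one vertex, hence everywhere.\<close>
        using square_extension[where A = A, OF sq A less.prems 3(1-3) ov(1) 3(4)[symmetric] ov(2) 3(5)[symmetric] IH(3)]
        by blast
      have fX: "f i (?vw i) = X (i, ?vw i)" if "i \<in> {1..m}" for i
        using fun_cong[OF f(1), of i] that by (simp add: pull_def)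
      have "(\<lambda>i. if i \<in> {1..m} then f i (?v i) else 0) = pull m ?v X"
      proof (rule char_relK_determined[OF _ f(2) IH(1) 3(2)])
        fix i assume "i \<noteq> w"
        then show "(if i \<in> {1..m} then f i (?v i) else 0) = pull m ?v X i"
          using fX[of i] by (auto simp: pull_def)
      qed (use A IJ in auto)
      \<comment> \<open>The index of \<open>?v\<close> at \<open>w\<close> is still
        \<open>\<alpha> w\<close>, so this corner fixes the value there; \<open>?w\<close> does the
        same at \<open>v\<close>. Together they cover every vertex read by
        \<open>pull m \<alpha>\<close>.\<close>
      then have fw: "f w (\<alpha> w) = X (w, \<alpha> w)" using 3 by (auto simp: pull_def fun_eq_iff split: if_splits)
      have "(\<lambda>i. if i \<in> {1..m} then f i (?w i) else 0) = pull m ?w X"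
      proof (rule char_relK_determined[OF _ f(2) IH(2) 3(1)])
        fix i assume "i \<noteq> v"
        then show "(if i \<in> {1..m} then f i (?w i) else 0) = pull m ?w X i"
          using fX[of i] by (auto simp: pull_def)
      qed (use A IJ in auto)
      then have fv: "f v (\<alpha> v) = X (v, \<alpha> v)" using 3 by (auto simp: pull_def fun_eq_iff split: if_splits)
      have "(if i \<in> {1..m} then f i (\<alpha> i) else 0) = pull m \<alpha> X i" for i
        using fX[of i] fv fw by (cases "i = v \<or> i = w") (auto simp: pull_def)
      then have "(\<lambda>i. if i \<in> {1..m} then f i (\<alpha> i) else 0) = pull m \<alpha> X" by (rule ext)
      then show ?thesis using f(2)[of \<alpha>] by simp
    qed
  qed
  moreover have "X \<in> supported_on (VJ m J)" by (auto simp: X_def supported_on_def)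
  ultimately show ?thesis using po by blast
qed

lemma subsquares_imp_realizable:
  assumes J: "\<forall>i\<in>{1..m}. 0 < J i" and puz: "is_puzzle K m n J p"
    and sq: "all_subsquares_realizable K m n J p"
  shows "realizable K m n J p"
proof -
  have "\<forall>\<alpha>. \<exists>B. \<alpha> \<in> IJ m J \<longrightarrow> char_relK B \<and> p \<alpha> = class_of B"
    using puz by (auto simp: is_puzzle_def DJ_classes_eq)
  then obtain A where A: "\<And>\<alpha>. \<alpha> \<in> IJ m J \<Longrightarrow> char_relK (A \<alpha>) \<and> p \<alpha> = class_of (A \<alpha>)"
    by metis
  have sA: "submodule (A \<alpha>)" if "\<alpha> \<in> IJ m J" for \<alpha> using A that by (simp add: char_relations_def)
  define P where "P = {X \<in> supported_on (VJ m J). \<forall>\<alpha>\<in>IJ m J. pull m \<alpha> X \<in> A \<alpha>}"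
  have 0: "pull m \<alpha> (\<lambda>_. 0) = (\<lambda>_. 0)"
    and 1: "pull m \<alpha> (\<lambda>v. x v + y v) = (\<lambda>v. pull m \<alpha> x v + pull m \<alpha> y v)"
    and 2: "pull m \<alpha> (\<lambda>v. a * x v) = (\<lambda>v. a * pull m \<alpha> x v)" for x y :: "nat \<times> nat \<Rightarrow> 'a" and a \<alpha>
    by (auto simp: pull_def)
  have "submodule P"
    unfolding submodule_def P_def
    using sA by (auto simp: 0 1 2 supported_on_def intro: submodule_add submodule_scale)
      (simp add: submodule_def)
  moreover have "P \<subseteq> supported_on (VJ m J)" by (auto simp: P_def)
  \<comment> \<open>\<open>P\<close> is the largest supported module whose pullbacks stay inside the
    \<open>A \<alpha>\<close>; equality holds because a global section exists with
    \<open>\<alpha>\<close> as base.\<close>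
  moreover have pull: "pull m \<alpha> ` P = A \<alpha>" if \<alpha>: "\<alpha> \<in> IJ m J" for \<alpha>
  proof
    show "pull m \<alpha> ` P \<subseteq> A \<alpha>" using \<alpha> by (auto simp: P_def)
    show "A \<alpha> \<subseteq> pull m \<alpha> ` P"
    proof
      fix x assume x: "x \<in> A \<alpha>"
      have "\<exists>X\<in>supported_on (VJ m J). pull m \<alpha> X = x \<and> (\<forall>\<beta>\<in>IJ m J. pull m \<beta> X \<in> A \<beta>)"
        using puz sq A \<alpha> x by (rule exists_global_section)
      then obtain X where "X \<in> P" "pull m \<alpha> X = x" by (auto simp: P_def)
      then show "x \<in> pull m \<alpha> ` P" by blast
    qed
  qed
  ultimately have "char_relJ J P" using A by (intro char_relJ_of_pull[OF J]) auto
  then show ?thesis unfolding realizable_iff[OF J] using pull A by (intro exI[of _ P]) simp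
qed

section \<open>The correspondence between D-J classes over K(J) and puzzles\<close>

text \<open>Choose \<open>y\<close> in \<open>Q\<close> with the pullback of \<open>x\<close> along
  \<open>base\<close>. Moving one index of \<open>base\<close> to \<open>k\<close> gives pullbacks
  of \<open>x\<close> and \<open>y\<close> in the same module that agree off one vertex, hence also
  at the moved vertex; this reaches all of K(J).\<close>

lemma char_relJ_subset:
  assumes J: "\<forall>i\<in>{1..m}. 0 < J i" and P: "char_relJ J P" and Q: "char_relJ J Q"
    and eq: "\<And>\<alpha>. \<alpha> \<in> IJ m J \<Longrightarrow> pull m \<alpha> ` P = pull m \<alpha> ` Q"
  shows "P \<subseteq> Q"
proof
  fix x assume x: "x \<in> P"
  define base :: "nat \<Rightarrow> nat" where "base = (\<lambda>i. if i \<in> {1..m} then 1 else 0)"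
  have o: "base \<in> IJ m J" unfolding base_def by (rule IJ_nonempty[OF J])
  have "pull m base x \<in> pull m base ` Q" using x eq[OF o] by blast
  then obtain y where y: "y \<in> Q" "pull m base x = pull m base y" by blast
  have "x u = y u" for u
  proof (cases "u \<in> VJ m J")
    case False
    moreover have "x \<in> supported_on (VJ m J)" "y \<in> supported_on (VJ m J)"
      using x y P Q by (auto simp: char_relations_def)
    ultimately show ?thesis by (cases u) (auto simp: supported_on_def)
  next
    case True
    then obtain i k where u: "u = (i, k)" "i \<in> {1..m}" "1 \<le> k" "k \<le> J i" by (auto simp: VJ_def)
    define \<beta> where "\<beta> = base(i := k)"
    have \<beta>: "\<beta> \<in> IJ m J" unfolding \<beta>_def using IJ_update o u by blast
    have "pull m \<beta> x = pull m \<beta> y"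
    proof (rule char_relK_determined[OF char_relK_pull[OF J Q \<beta>] _ _ u(2)])
      show "pull m \<beta> x \<in> pull m \<beta> ` Q" using x eq[OF \<beta>] by blast
      show "pull m \<beta> y \<in> pull m \<beta> ` Q" using y by blast
      show "pull m \<beta> x j = pull m \<beta> y j" if "j \<noteq> i" for j
        using that fun_cong[OF y(2), of j] by (auto simp: pull_def \<beta>_def split: if_splits)
    qed
    from fun_cong[OF this, of i] show ?thesis using u by (simp add: pull_def \<beta>_def)
  qed
  then have "x = y" by blast
  then show "x \<in> Q" using y by simp
qed

lemma puzzle_of_eq_iff:
  assumes J: "\<forall>i\<in>{1..m}. 0 < J i" and L1: "char_mapJ J L1" and L2: "char_mapJ J L2"
  shows "puzzle_of K m n J L1 = puzzle_of K m n J L2 \<longleftrightarrow> DJ_equiv (VJ m J) (dimJ m n J) L1 L2"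
proof -
  let ?R1 = "relations (VJ m J) L1" and ?R2 = "relations (VJ m J) L2"
  have R: "char_relJ J ?R1" "char_relJ J ?R2" using L1 L2 by (auto intro: char_relJ_relations)
  have "puzzle_of K m n J L1 = puzzle_of K m n J L2 \<longleftrightarrow>
    (\<forall>\<alpha>\<in>IJ m J. class_of (pull m \<alpha> ` ?R1) = class_of (pull m \<alpha> ` ?R2))"
    using proj_class_eq[OF J L1] proj_class_eq[OF J L2]
    unfolding puzzle_of_def by (auto simp: restrict_def fun_eq_iff)
  also have "\<dots> \<longleftrightarrow> (\<forall>\<alpha>\<in>IJ m J. pull m \<alpha> ` ?R1 = pull m \<alpha> ` ?R2)"
    using class_of_inject[OF char_relK_pull[OF J R(1)]] by metis
  also have "\<dots> \<longleftrightarrow> ?R1 = ?R2"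
    using char_relJ_subset[OF J R] char_relJ_subset[OF J R(2) R(1)] by (metis subset_antisym)
  also have "\<dots> \<longleftrightarrow> DJ_equiv (VJ m J) (dimJ m n J) L1 L2"
    using KJ_facet_exists[OF J] DJ_equiv_iff_relations[OF finite_VJ KJ_subset _ _ L1 L2] by blast
  finally show ?thesis .
qed

text \<open>Each edge is witnessed by reindexing \<open>P\<close> to the wedge at \<open>v\<close>,
  whose two vertices over \<open>v\<close> go to the two endpoints' indices. Thus the puzzle
  condition holds automatically for maps over K(J).\<close>

lemma realizable_imp_puzzle:
  fixes p :: "(nat \<Rightarrow> nat) \<Rightarrow> (nat \<Rightarrow> nat \<Rightarrow> 'r::comm_ring_1) set"
  assumes J: "\<forall>i\<in>{1..m}. 0 < J i" and r: "realizable K m n J p"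
  shows "is_puzzle K m n J p"
proof -
  obtain P where P: "char_relJ J P" "\<And>\<alpha>. \<alpha> \<in> IJ m J \<Longrightarrow> p \<alpha> = class_of (pull m \<alpha> ` P)"
    using r unfolding realizable_iff[OF J] by blast
  have "D_edge_dir K m n TYPE('r) v (p \<alpha>) (p \<beta>)"
    if \<alpha>: "\<alpha> \<in> IJ m J" and \<beta>: "\<beta> \<in> IJ m J" and v: "v \<in> {1..m}"
      and off: "\<And>i. i \<noteq> v \<Longrightarrow> \<alpha> i = \<beta> i" for \<alpha> \<beta> v
  proof -
    \<comment> \<open>Index 2 goes with \<open>\<alpha>\<close> because \<open>D_edge_dir\<close>
      reads its first class at \<open>wedge_alpha m v 2\<close>. Off \<open>v\<close> only index 1
      occurs, where \<open>\<alpha>\<close> and \<open>\<beta>\<close> agree.\<close>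
    define s where "s = (\<lambda>i k::nat. if k = 2 then \<alpha> i else \<beta> i)"
    let ?Q = "reindex m (wedgeJ v) s ` P"
    have sel: "(\<lambda>i. if i \<in> {1..m} then s i (wedge_alpha m v 2 i) else 0) = \<alpha>"
      "(\<lambda>i. if i \<in> {1..m} then s i (wedge_alpha m v 1 i) else 0) = \<beta>"
      using \<alpha> \<beta> off by (auto simp: s_def wedge_alpha_def IJ_def)
    have "char_relJ (wedgeJ v) ?Q"
      using \<alpha> \<beta> by (intro char_relJ_reindex[OF J wedgeJ_pos _ P(1)]) (auto simp: s_def IJ_def)
    moreover have "pull m (wedge_alpha m v 2) (reindex m (wedgeJ v) s x) = pull m \<alpha> x"
      "pull m (wedge_alpha m v 1) (reindex m (wedgeJ v) s x) = pull m \<beta> x" for x :: "nat \<times> nat \<Rightarrow> 'r"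
      by (subst pull_reindex[OF wedge_alpha_IJ]; simp only: sel insert_iff simp_thms)+
    then have "p \<alpha> = class_of (pull m (wedge_alpha m v 2) ` ?Q)"
      "p \<beta> = class_of (pull m (wedge_alpha m v 1) ` ?Q)"
      using P(2) \<alpha> \<beta> unfolding image_image by simp_all
    ultimately show ?thesis unfolding D_edge_dir_iff by blast
  qed
  then show ?thesis
    using P char_relK_pull[OF J P(1)] by (auto simp: is_puzzle_def DJ_classes_eq D_edge_def)
qed

lemma realizable_iff_subsquares:
  assumes "\<forall>i\<in>{1..m}. 0 < J i" "is_puzzle K m n J p"
  shows "realizable K m n J p \<longleftrightarrow> all_subsquares_realizable K m n J p"
  using realizable_imp_subsquares subsquares_imp_realizable assms by blast

lemma puzzle_of_image:
  assumes J: "\<forall>i\<in>{1..m}. 0 < J i"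
  shows "puzzle_of K m n J ` {L :: nat \<times> nat \<Rightarrow> nat \<Rightarrow> 'r::comm_ring_1. char_mapJ J L}
    = {p \<in> extensional (IJ m J). is_puzzle K m n J p \<and> all_subsquares_realizable K m n J p}"
proof (intro set_eqI iffI)
  fix p :: "(nat \<Rightarrow> nat) \<Rightarrow> (nat \<Rightarrow> nat \<Rightarrow> 'r) set"
  assume "p \<in> puzzle_of K m n J ` {L. char_mapJ J L}"
  then obtain L where L: "char_mapJ J L" "p = puzzle_of K m n J L" by blast
  then have "realizable K m n J p"
    unfolding realizable_def by (intro exI[of _ L]) (simp add: puzzle_of_def)
  moreover have "p \<in> extensional (IJ m J)" using L(2) by (simp add: puzzle_of_def)
  ultimately show "p \<in> {p \<in> extensional (IJ m J).
      is_puzzle K m n J p \<and> all_subsquares_realizable K m n J p}"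
    using realizable_imp_puzzle[OF J] realizable_imp_subsquares[OF J] by blast
next
  fix p :: "(nat \<Rightarrow> nat) \<Rightarrow> (nat \<Rightarrow> nat \<Rightarrow> 'r) set"
  assume p: "p \<in> {p \<in> extensional (IJ m J).
      is_puzzle K m n J p \<and> all_subsquares_realizable K m n J p}"
  then have "realizable K m n J p" using subsquares_imp_realizable[OF J] by blast
  then obtain L where L: "char_mapJ J L" "\<forall>\<alpha>\<in>IJ m J. p \<alpha> = proj_class K m n J L \<alpha>"
    unfolding realizable_def by (elim exE conjE)
  then have "p = puzzle_of K m n J L"
    using p unfolding puzzle_of_def by (intro extensionalityI[of _ "IJ m J"]) auto
  then show "p \<in> puzzle_of K m n J ` {L. char_mapJ J L}" using L(1) by blast
qed

end

theorem mainTheorem11: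
  fixes K :: "nat set set" and m n :: nat and J :: "nat \<Rightarrow> nat"
  assumes R: "bij (of_int :: int \<Rightarrow> 'r::comm_ring_1) \<or> CARD('r) = 2"
    and n: "n = CARD('n::finite)"
    and K: "simplicial_complex_on K m"
    and sphere: "star_shaped_sphere K TYPE('n)"
    and J: "\<forall>i\<in>{1..m}. 0 < J i"
  shows "(\<forall>p :: (nat \<Rightarrow> nat) \<Rightarrow> (nat \<Rightarrow> nat \<Rightarrow> 'r) set.
            is_puzzle K m n J p \<longrightarrow>
              (realizable K m n J p \<longleftrightarrow> all_subsquares_realizable K m n J p))
       \<and> (\<forall>L1 L2 :: nat \<times> nat \<Rightarrow> nat \<Rightarrow> 'r.
            char_map (KJ K m J) (VJ m J) (dimJ m n J) L1 \<longrightarrow>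
            char_map (KJ K m J) (VJ m J) (dimJ m n J) L2 \<longrightarrow>
              (puzzle_of K m n J L1 = puzzle_of K m n J L2 \<longleftrightarrow> DJ_equiv (VJ m J) (dimJ m n J) L1 L2))
       \<and> puzzle_of K m n J ` {L :: nat \<times> nat \<Rightarrow> nat \<Rightarrow> 'r. char_map (KJ K m J) (VJ m J) (dimJ m n J) L}
           = {p \<in> extensional (IJ m J). is_puzzle K m n J p \<and> all_subsquares_realizable K m n J p}"
proof -
  interpret pure_complex K m n
  proof
    show "simplicial_complex_on K m" by (rule K)
    show "card \<sigma> \<le> n" if "\<sigma> \<in> K" for \<sigma>
      using sphere that by (simp add: star_shaped_sphere_def n)
    show "\<exists>\<sigma>\<in>K. card \<sigma> = n"
      using sphere by (simp add: star_shaped_sphere_def n)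
    \<comment> \<open>Among the four axioms, this one alone rests on the geometry of the embedded
      sphere.\<close>
    show "\<exists>\<sigma>\<in>K. i \<in> \<sigma> \<and> card \<sigma> = n" if "i \<in> {1..m}" for i
      using star_shaped_sphere_vertex_in_facet[OF K sphere that] n by simp
  qed
  show ?thesis
    using realizable_iff_subsquares[OF J] puzzle_of_eq_iff[OF J] puzzle_of_image[OF J] by blast
qed

end
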